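(* Let $\mathcal{A} = \{X_1, \dots, X_n\}$ be a set of real-valued random variables on a common probability space with $a_i \leq X_i \leq b_i$ for some $a_i, b_i \in \mathbb{R}$, $i=1,\dots,n$, and let $r(\mathcal{A}) = \max_{1\leq i\leq n}|b_i-a_i|$. Then, for any threshold $\gamma > 0$, any $t > 0$ and any $0<\lambda < t$, $$\mathbb{P}\Big[\frac{1}{n}\sum_{i=1}^n X_i - \frac{1}{n} \sum_{i=1}^n\mathbb{E}[X_i] > t \Big] \leq \exp\Big(-\frac{n^2(t-\lambda)^2}{2\chi^\star_\gamma(\mathcal{A}) \sum_{i=1}^n(b_i-a_i)^2}\Big) + \exp\Big(-\frac{n^2(t-\lambda)^2}{2 \sum_{i=1}^n(b_i-a_i)^2}\Big) + 18\,n\,\gamma\,\sqrt{\frac{r(\mathcal{A})}{\lambda}}.$$ This can be further upper bounded by a less tight expression, giving $$\mathbb{P}\Big[\frac{1}{n}\sum_{i=1}^n X_i - \frac{1}{n} \sum_{i=1}^n\mathbb{E}[X_i] > t \Big] \leq 2\exp\Big(-\frac{n^2(t-\lambda)^2}{2\chi^\star_\gamma(\mathcal{A}) \sum_{i=1}^n(b_i-a_i)^2}\Big) + 18\,n\,\gamma\,\sqrt{\frac{r(\mathcal{A})}{\lambda}}.$$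
   Context: For two sub-$\sigma$-algebras $\mathcal{B},\mathcal{C}$ of a probability space $(\Omega,\mathcal{F},\mathbb{P})$, $\alpha(\mathcal{B}|\mathcal{C}) = \sup_{B\in\mathcal{B}, C\in\mathcal{C}} |\mathbb{P}[B\cap C] - \mathbb{P}[B]\mathbb{P}[C]|$. For random variables (or families of random variables) $X,Y$, $\alpha(X|Y) = \alpha(\sigma(X)|\sigma(Y))$, where $\sigma(\cdot)$ is the generated $\sigma$-algebra. The $\alpha$-separation coefficient of a set of random variables $\{Z_1,\dots,Z_k\}$ is $$\vec{\alpha}(\{Z_1,\dots,Z_k\}) = \min_{\pi\in\Pi_k} \frac{1}{k}\sum_{i=1}^{k-1}\alpha\big(Z_{\pi(i)} \,\big|\, \{Z_{\pi(i+1)},\dots,Z_{\pi(k)}\}\big),$$ with $\Pi_k$ the set of all permutations of $1,\dots,k$. For a set of random variables $\mathcal{A}=\{X_1,\dots,X_n\}$ and an index set $\mathcal{I}\subseteq[n]=\{1,\dots,n\}$, write $\vec{\alpha}(\mathcal{I})$ for the $\alpha$-separation coefficient of $\{X_i : i\in\mathcal{I}\}$. Given $\gamma\ge 0$, $\mathcal{I}\subseteq[n]$ is called $\gamma$-independent if $\vec{\alpha}(\mathcal{I})\leq\gamma$. A family $\{(\mathcal{I}_j,w_j)\}_j$ with $\mathcal{I}_j\subseteq[n]$ and $w_j\in[0,1]$ is a fractional cover of $\mathcal{A}$ if $\sum_{j: i\in\mathcal{I}_j}w_j\geq 1$ for all $1\le i\le n$; it is soft (for the threshold $\gamma$) if each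 $\mathcal{I}_j$ is $\gamma$-independent. $\chi^\star_\gamma(\mathcal{A})$ is the minimum of $\sum_j w_j$ over all soft fractional covers $\{(\mathcal{I}_j,w_j)\}_j$ of $\mathcal{A}$ for the given $\gamma$. *)

theory Defs
  imports "HOL-Probability.Probability" "HOL-Combinatorics.Multiset_Permutations"
begin

definition alpha_coeff :: "'a measure \<Rightarrow> 'a set set \<Rightarrow> 'a set set \<Rightarrow> real" where
  "alpha_coeff M \<B> \<C> =
     (SUP (B, C)\<in>\<B> \<times> \<C>. \<bar>measure M (B \<inter> C) - measure M B * measure M C\<bar>)"

(* The sigma-algebra on space M generated by the random variables X i, i in I. *)
definition generated_sigma ::
    "'a measure \<Rightarrow> ('i \<Rightarrow> 'a \<Rightarrow> real) \<Rightarrow> 'i set \<Rightarrow> 'a set set" where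
  "generated_sigma M X I =
     sigma_sets (space M) (\<Union>i\<in>I. {X i -` A \<inter> space M | A. A \<in> sets borel})"

definition alpha_rv ::
    "'a measure \<Rightarrow> ('i \<Rightarrow> 'a \<Rightarrow> real) \<Rightarrow> 'i set \<Rightarrow> 'i set \<Rightarrow> real" where
  "alpha_rv M X I J = alpha_coeff M (generated_sigma M X I) (generated_sigma M X J)"

(* Coefficient of the indexed family (X i) for i in I, with k = card I.  The lists xs in
   permutations_of_set I are the k! orderings of I (xs ! (i - 1) plays the role of
   Z_pi(i)); positions are counted from 0, so the sum over 1, ..., k - 1 runs over i < k - 1
   and the tail Z_pi(i+1), ..., Z_pi(k) is {i + 1..<k}.  The value is 0 if k is 0 or 1. *)
definition alpha_separation ::
    "'a measure \<Rightarrow> ('i \<Rightarrow> 'a \<Rightarrow> real) \<Rightarrow> 'i set \<Rightarrow> real" where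
  "alpha_separation M X I =
     (MIN xs\<in>permutations_of_set I.
        (1 / real (card I)) *
        (\<Sum>i<card I - 1. alpha_rv M X {xs ! i} ((\<lambda>j. xs ! j) ` {i + 1..<card I})))"

definition gamma_independent ::
    "'a measure \<Rightarrow> ('i \<Rightarrow> 'a \<Rightarrow> real) \<Rightarrow> real \<Rightarrow> 'i set \<Rightarrow> bool" where
  "gamma_independent M X \<gamma> I \<longleftrightarrow> alpha_separation M X I \<le> \<gamma>"

definition fractional_cover ::
    "nat \<Rightarrow> nat set \<Rightarrow> (nat \<Rightarrow> nat set) \<Rightarrow> (nat \<Rightarrow> real) \<Rightarrow> bool" where
  "fractional_cover n J I w \<longleftrightarrow>
     finite J \<and>
     (\<forall>j\<in>J. I j \<subseteq> {1..n} \<and> 0 \<le> w j \<and> w j \<le> 1) \<and>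
     (\<forall>i\<in>{1..n}. (\<Sum>j\<in>{j\<in>J. i \<in> I j}. w j) \<ge> 1)"

definition soft_fractional_cover ::
    "'a measure \<Rightarrow> (nat \<Rightarrow> 'a \<Rightarrow> real) \<Rightarrow> nat \<Rightarrow> real \<Rightarrow>
     nat set \<Rightarrow> (nat \<Rightarrow> nat set) \<Rightarrow> (nat \<Rightarrow> real) \<Rightarrow> bool" where
  "soft_fractional_cover M X n \<gamma> J I w \<longleftrightarrow>
     fractional_cover n J I w \<and> (\<forall>j\<in>J. gamma_independent M X \<gamma> (I j))"

(* For \<gamma> \<ge> 0 the singletons form a soft cover, and the infimum is a minimum: merging
   equal index sets and capping their weight at 1 leaves a linear program over a compact
   polytope. *)
definition soft_fractional_chromatic ::
    "'a measure \<Rightarrow> (nat \<Rightarrow> 'a \<Rightarrow> real) \<Rightarrow> nat \<Rightarrow> real \<Rightarrow> real" where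
  "soft_fractional_chromatic M X n \<gamma> =
     Inf {\<Sum>j\<in>J. w j | J I w. soft_fractional_cover M X n \<gamma> J I w}"

end

theory Submission
  imports Defs
begin

text \<open>
  Write \<open>\<tau> = n t\<close>, \<open>S\<close> for the centred sum and \<open>s\<close> for the sum of the squared widths. For every soft
  fractional cover of total weight \<open>W\<close> the sharper bound
  \<open>P (S > \<tau>) \<le> exp (- \<tau>\<^sup>2 / (2 W s)) + 2 n \<gamma> sqrt (r / t)\<close> holds;
  the theorem follows by taking the infimum over the covers and using \<open>0 < l < t\<close>.

  The usual route estimates the exponential moment of \<open>S\<close>. Inside one class of the cover the variables
  are only nearly independent, and the error made by treating them as independent is multiplied by the
  size of the test function, which is out of control for \<open>exp\<close>. Two observations repair this.

  First, for a nondecreasing \<open>L\<close>-Lipschitz \<open>\<phi>\<close> and a variable \<open>Z\<close> of width \<open>d\<close>, replacing \<open>Z\<close> in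
  \<open>E \<phi> (Z + R)\<close> by a copy independent of \<open>R\<close> costs at most \<open>\<alpha> L d\<close>, where \<open>\<alpha>\<close> is the dependence
  coefficient of \<open>Z\<close> and \<open>R\<close> (lemma \<open>expectation_decouple_le\<close>). Only the slope of \<open>\<phi>\<close> enters. Doing
  this along a good ordering of a class, and estimating the copies by Hoeffding's lemma, bounds
  \<open>E \<phi>\<close> of the sum over the class by an exponential plus \<open>L \<Sum> d i \<alpha> i\<close>
  (lemma \<open>expectation_sum_list_le\<close>).

  Second, the exponent in the theorem is a quarter of the one in Hoeffding's inequality. Hence \<open>\<phi>\<close> may
  be taken as an exponential only up to \<open>\<tau> / 2\<close>, continued linearly beyond. The level \<open>\<tau> / 2\<close> already
  yields the exponent wanted, and the linear part, which must climb to \<open>1\<close> at \<open>\<tau>\<close>, keeps the slope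
  below \<open>2 / \<tau>\<close>.

  The classes are combined by convexity with the weights of Janson's inequality
  (lemma \<open>soft_cover_tail_bound_centered\<close>). The dependence errors then add up to at most
  \<open>n \<gamma>\<close> times the slope times the smaller of the total width and \<open>r W\<close>, and a balance of these two
  bounds makes the result independent of \<open>W\<close> and \<open>s\<close> (lemma \<open>truncation_error_le\<close>).
\<close>

section \<open>The test function\<close>

text \<open>
  The linear branch is the tangent of \<open>exp\<close> at \<open>0\<close>. What the argument needs from this function
  is that it is convex, nondecreasing and \<open>1\<close>-Lipschitz, lies below \<open>exp\<close>, so that moment
  generating functions still bound its expectation, and lies above \<open>1 + y\<close>.
\<close>

definition exp_linear :: "real \<Rightarrow> real" where
  "exp_linear y = (if y \<le> 0 then exp y else 1 + y)"

text \<open>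
  The slope \<open>min 1 (exp x)\<close> is the derivative, and all the properties used later are read off from
  this one inequality: monotonicity and the Lipschitz bound because the slope lies in \<open>[0, 1]\<close>, and
  Jensen's inequality by averaging the supporting line at the barycentre.
\<close>

lemma exp_linear_supporting_line:
  "exp_linear x + min 1 (exp x) * (y - x) \<le> exp_linear y"
proof -
  have e: "exp x + exp x * (y - x) \<le> exp y"
    using exp_ge_add_one_self[of "y - x"] mult_left_mono[of "1 + (y - x)" "exp (y - x)" "exp x"]
    by (simp add: algebra_simps flip: exp_add)
  have y1: "1 + y \<le> exp y" by (rule exp_ge_add_one_self)
  show ?thesis
  proof (cases "x \<le> 0")
    case x: True
    show ?thesis
    proof (cases "y \<le> 0")
      case True
      then show ?thesis using x e by (simp add: exp_linear_def)
    next
      case False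
      have "exp x + exp x * (- x) \<le> 1"
        using exp_ge_add_one_self[of "- x"] mult_left_mono[of "1 + (- x)" "exp (- x)" "exp x"]
        by (simp add: algebra_simps flip: exp_add)
      moreover have "exp x * y \<le> y"
        using x False by (simp add: mult_le_cancel_right1)
      ultimately have "exp x + exp x * (y - x) \<le> 1 + y"
        unfolding right_diff_distrib by linarith
      then show ?thesis using x False by (simp add: exp_linear_def)
    qed
  next
    case False
    then show ?thesis using y1 by (simp add: exp_linear_def min_def)
  qed
qed

lemma exp_linear_increment:
  assumes "x \<le> y"
  shows "exp_linear x \<le> exp_linear y" "exp_linear y - exp_linear x \<le> y - x"
proof -
  have "0 \<le> min 1 (exp x) * (y - x)" using assms by simp
  then show "exp_linear x \<le> exp_linear y" using exp_linear_supporting_line[of x y] by linarith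
  have "min 1 (exp y) * (y - x) \<le> 1 * (y - x)" using assms by (intro mult_right_mono) auto
  then show "exp_linear y - exp_linear x \<le> y - x"
    using exp_linear_supporting_line[of y x] by (simp add: algebra_simps)
qed

lemma exp_linear_nonneg: "0 \<le> exp_linear y"
  by (simp add: exp_linear_def)

lemma exp_linear_ge: "1 + y \<le> exp_linear y"
  by (simp add: exp_linear_def exp_ge_add_one_self)

lemma exp_linear_le_exp: "exp_linear y \<le> exp y"
  by (simp add: exp_linear_def exp_ge_add_one_self)

lemma exp_linear_Jensen:
  assumes "finite J" "\<And>j. j \<in> J \<Longrightarrow> 0 \<le> p j" "(\<Sum>j\<in>J. p j) = 1"
  shows "exp_linear (\<Sum>j\<in>J. p j * y j) \<le> (\<Sum>j\<in>J. p j * exp_linear (y j))"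
proof -
  define x where "x = (\<Sum>j\<in>J. p j * y j)"
  define g where "g = min 1 (exp x)"
  have "(\<Sum>j\<in>J. p j * (exp_linear x + g * (y j - x)))
      = (\<Sum>j\<in>J. exp_linear x * p j + (g * (p j * y j) - (g * x) * p j))"
    by (intro sum.cong) (auto simp: algebra_simps)
  also have "\<dots> = exp_linear x * (\<Sum>j\<in>J. p j) + (g * x - (g * x) * (\<Sum>j\<in>J. p j))"
    unfolding sum.distrib sum_subtractf sum_distrib_left[symmetric] x_def[symmetric] ..
  also have "\<dots> = exp_linear x" using assms(3) by simp
  finally have "exp_linear x = (\<Sum>j\<in>J. p j * (exp_linear x + g * (y j - x)))" ..
  also have "\<dots> \<le> (\<Sum>j\<in>J. p j * exp_linear (y j))"
    unfolding g_def by (intro sum_mono mult_left_mono exp_linear_supporting_line assms)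
  finally show ?thesis by (simp add: x_def)
qed

section \<open>Replacing a variable by an independent copy\<close>

text \<open>
  Rounding \<open>x\<close> up to the grid \<open>lo, lo + h, \<dots>\<close> turns \<open>\<phi> x\<close> into a telescoping sum in which \<open>x\<close>
  occurs only through the indicators of \<open>lo + m h < x\<close>. It is a discrete form of
  \<open>\<phi> x = \<phi> lo + \<integral> 1[s < x] d\<phi>(s)\<close>, valid for an arbitrary function \<open>\<phi>\<close>.
\<close>

lemma staircase_sum:
  fixes \<phi> :: "real \<Rightarrow> real"
  assumes h: "0 \<le> h" and x: "lo \<le> x" "x \<le> lo + real N * h"
  obtains u where "x \<le> u" "u \<le> x + h"
    "\<phi> lo + (\<Sum>m<N. of_bool (lo + real m * h < x) *
        (\<phi> (lo + real (Suc m) * h) - \<phi> (lo + real m * h))) = \<phi> u"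
proof -
  \<comment> \<open>the number of the grid point to which \<open>x\<close> is rounded up\<close>
  define k where "k = (LEAST k. x \<le> lo + real k * h)"
  have k: "x \<le> lo + real k * h" unfolding k_def by (rule LeastI) (rule x(2))
  have kN: "k \<le> N" unfolding k_def by (rule Least_le) (rule x(2))
  have below: "lo + real m * h < x \<longleftrightarrow> m < k" for m
  proof
    assume *: "lo + real m * h < x"
    show "m < k"
    proof (rule ccontr)
      assume "\<not> m < k"
      then have "real k * h \<le> real m * h" using h by (intro mult_right_mono) auto
      then show False using * k by linarith
    qed
  next
    assume "m < k"
    then show "lo + real m * h < x" unfolding k_def using not_less_Least by fastforce
  qed
  have up: "lo + real k * h \<le> x + h"
  proof (cases k)
    case 0 then show ?thesis using x h by simp
  next
    case (Suc m)
    then show ?thesis using below[of m] by (simp add: algebra_simps)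
  qed
  have "(\<Sum>m<N. of_bool (lo + real m * h < x) *
        (\<phi> (lo + real (Suc m) * h) - \<phi> (lo + real m * h)))
      = (\<Sum>m<k. \<phi> (lo + real (Suc m) * h) - \<phi> (lo + real m * h))"
    using kN by (intro sum.mono_neutral_cong_right) (auto simp: below)
  also have "\<dots> = \<phi> (lo + real k * h) - \<phi> lo"
    by (subst sum_lessThan_telescope) simp
  finally show ?thesis using that[OF k up] by simp
qed

lemma staircase_bounds:
  fixes \<phi> :: "real \<Rightarrow> real"
  assumes "0 \<le> h" "lo \<le> x" "x \<le> lo + real N * h"
    and mono: "mono \<phi>" and Lip: "\<And>x y. x \<le> y \<Longrightarrow> \<phi> y - \<phi> x \<le> L * (y - x)" and "0 \<le> L"
  defines "S \<equiv> \<phi> lo + (\<Sum>m<N. of_bool (lo + real m * h < x) *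
        (\<phi> (lo + real (Suc m) * h) - \<phi> (lo + real m * h)))"
  shows "\<phi> x \<le> S" "S \<le> \<phi> x + L * h"
proof -
  obtain u where u: "x \<le> u" "u \<le> x + h" "S = \<phi> u"
    using staircase_sum[OF assms(1-3), of \<phi>] unfolding S_def by blast
  show "\<phi> x \<le> S" using u mono by (simp add: mono_def)
  have "L * (u - x) \<le> L * h" using u \<open>0 \<le> L\<close> by (intro mult_left_mono) auto
  then show "S \<le> \<phi> x + L * h" using Lip[OF u(1)] u(3) by linarith
qed

context prob_space
begin

lemma integrable_bounded_mono_comp:
  fixes \<phi> :: "real \<Rightarrow> real"
  assumes "mono \<phi>" "R \<in> borel_measurable M" "\<And>\<omega>. \<omega> \<in> space M \<Longrightarrow> \<bar>R \<omega>\<bar> \<le> K"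
  shows "integrable M (\<lambda>\<omega>. \<phi> (R \<omega>))"
proof (rule integrable_const_bound[where B = "\<bar>\<phi> K\<bar> + \<bar>\<phi> (-K)\<bar>"])
  show "(\<lambda>\<omega>. \<phi> (R \<omega>)) \<in> borel_measurable M"
    using borel_measurable_mono[OF assms(1)] assms(2) by measurable
  have "norm (\<phi> (R \<omega>)) \<le> \<bar>\<phi> K\<bar> + \<bar>\<phi> (- K)\<bar>" if "\<omega> \<in> space M" for \<omega>
  proof -
    have "- K \<le> R \<omega>" "R \<omega> \<le> K" using assms(3)[OF that] by auto
    then have "\<phi> (- K) \<le> \<phi> (R \<omega>)" "\<phi> (R \<omega>) \<le> \<phi> K" using assms(1) by (auto simp: mono_def)
    then show ?thesis by auto
  qed
  then show "AE \<omega> in M. norm (\<phi> (R \<omega>)) \<le> \<bar>\<phi> K\<bar> + \<bar>\<phi> (- K)\<bar>" by simp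
qed

text \<open>
  By the layer-cake formula \<open>f\<close> is the integral over \<open>s \<in> [0, K]\<close> of the indicators of \<open>{s < f}\<close>,
  and each of these has covariance at most \<open>\<alpha>\<close> with \<open>B\<close>. The staircase replaces the integral by a
  sum of \<open>N\<close> layers of height \<open>K / N\<close>, which costs an error at most \<open>K / N\<close>.
\<close>

lemma covariance_event_bounded_le:
  fixes f :: "'a \<Rightarrow> real"
  assumes f [measurable]: "f \<in> borel_measurable M" and B [measurable]: "B \<in> events"
    and bd: "\<And>\<omega>. \<omega> \<in> space M \<Longrightarrow> 0 \<le> f \<omega> \<and> f \<omega> \<le> K"
    and dep: "\<And>s. prob (B \<inter> {\<omega> \<in> space M. s < f \<omega>}) - prob B * prob {\<omega> \<in> space M. s < f \<omega>} \<le> \<alpha>"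
  shows "expectation (\<lambda>\<omega>. indicator B \<omega> * f \<omega>) \<le> prob B * expectation f + \<alpha> * K"
proof (rule field_le_epsilon)
  fix \<epsilon> :: real assume "0 < \<epsilon>"
  obtain \<omega>0 where "\<omega>0 \<in> space M" using not_empty by blast
  then have K: "0 \<le> K" using bd[of \<omega>0] by simp
  obtain N where N: "K / \<epsilon> < real N" "0 < N"
    using reals_Archimedean2[of "max (K / \<epsilon>) 0"] by auto
  define h where "h = K / real N"
  have h: "0 \<le> h" "real N * h = K" "h \<le> \<epsilon>"
    using K N \<open>0 < \<epsilon>\<close> by (auto simp: h_def field_simps)
  \<comment> \<open>\<open>f\<close> rounded up to the next multiple of \<open>h\<close>\<close>
  define st where "st \<omega> = (\<Sum>m<N. indicator {\<omega> \<in> space M. real m * h < f \<omega>} \<omega> * h)" for \<omega>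
  have [measurable]: "st \<in> borel_measurable M" unfolding st_def by measurable
  have st: "f \<omega> \<le> st \<omega>" "st \<omega> \<le> f \<omega> + h" if w: "\<omega> \<in> space M" for \<omega>
  proof -
    have eq: "st \<omega> = id 0 + (\<Sum>m<N. of_bool (0 + real m * h < f \<omega>) *
        (id (0 + real (Suc m) * h) - id (0 + real m * h)))"
      using w by (auto simp: st_def indicator_def algebra_simps intro!: sum.cong)
    show "f \<omega> \<le> st \<omega>" "st \<omega> \<le> f \<omega> + h"
      using staircase_bounds[of h 0 "f \<omega>" N id 1] h bd[OF w] unfolding eq
      by (auto simp: mono_def)
  qed
  have int_f: "integrable M f"
    using bd by (intro integrable_const_bound[where B = K]) auto
  have int_st: "integrable M st" unfolding st_def
    by (intro Bochner_Integration.integrable_sum integrable_mult_left) (auto simp: emeasure_eq_measure)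
  have int_Bf: "integrable M (\<lambda>\<omega>. indicator B \<omega> * f \<omega>)"
    using bd K by (intro integrable_const_bound[where B = K] AE_I2) (auto simp: indicator_def)
  have int_B: "integrable M (\<lambda>\<omega>. indicator (B \<inter> {\<omega> \<in> space M. real m * h < f \<omega>}) \<omega> * h)" for m
    by (intro integrable_mult_left) (auto simp: emeasure_eq_measure)
  have Bst: "indicator B \<omega> * st \<omega> = (\<Sum>m<N. indicator (B \<inter> {\<omega> \<in> space M. real m * h < f \<omega>}) \<omega> * h)" for \<omega>
    unfolding st_def sum_distrib_left by (intro sum.cong) (auto simp: indicator_def)
  have "expectation (\<lambda>\<omega>. indicator B \<omega> * f \<omega>) \<le> expectation (\<lambda>\<omega>. indicator B \<omega> * st \<omega>)"
  proof (rule integral_mono)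
    show "integrable M (\<lambda>\<omega>. indicator B \<omega> * st \<omega>)"
      unfolding Bst by (intro Bochner_Integration.integrable_sum int_B)
  qed (use st int_Bf in \<open>auto intro!: mult_left_mono\<close>)
  also have "\<dots> = (\<Sum>m<N. prob (B \<inter> {\<omega> \<in> space M. real m * h < f \<omega>}) * h)"
    unfolding Bst by (subst Bochner_Integration.integral_sum[OF int_B]) simp
  also have "\<dots> \<le> (\<Sum>m<N. (prob B * prob {\<omega> \<in> space M. real m * h < f \<omega>} + \<alpha>) * h)"
    using dep h(1) by (intro sum_mono mult_right_mono) (auto simp: algebra_simps)
  also have "\<dots> = prob B * (\<Sum>m<N. prob {\<omega> \<in> space M. real m * h < f \<omega>} * h) + \<alpha> * K"
    by (simp add: algebra_simps sum.distrib sum_distrib_left flip: h(2))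
  also have "(\<Sum>m<N. prob {\<omega> \<in> space M. real m * h < f \<omega>} * h) = expectation st"
    unfolding st_def by (subst Bochner_Integration.integral_sum)
      (auto intro!: integrable_mult_left simp: emeasure_eq_measure)
  finally have "expectation (\<lambda>\<omega>. indicator B \<omega> * f \<omega>) \<le> prob B * expectation st + \<alpha> * K" .
  moreover have "expectation st \<le> expectation (\<lambda>\<omega>. f \<omega> + h)"
    using st int_st int_f by (intro integral_mono) auto
  then have "prob B * expectation st \<le> prob B * (expectation f + h)"
    using int_f by (intro mult_left_mono) (auto simp: prob_space)
  moreover have "prob B * (expectation f + h) \<le> prob B * expectation f + \<epsilon>"
    using h mult_mono[of "prob B" 1 h \<epsilon>] by (auto simp: algebra_simps)
  ultimately show "expectation (\<lambda>\<omega>. indicator B \<omega> * f \<omega>) \<le> prob B * expectation f + \<alpha> * K + \<epsilon>"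
    by linarith
qed

text \<open>
  Averaging over an independent copy of \<open>Z\<close> keeps a test function in the class of monotone Lipschitz
  functions, with the same constant. This is what allows the replacement below to be iterated.
\<close>

lemma translated_expectation:
  fixes \<phi> :: "real \<Rightarrow> real"
  assumes Z [measurable]: "Z \<in> borel_measurable M"
    and bd: "\<And>\<omega>. \<omega> \<in> space M \<Longrightarrow> lo \<le> Z \<omega> \<and> Z \<omega> \<le> hi"
    and mono: "mono \<phi>" and Lip: "\<And>x y. x \<le> y \<Longrightarrow> \<phi> y - \<phi> x \<le> L * (y - x)"
  shows "integrable M (\<lambda>\<omega>. \<phi> (Z \<omega> + y))"
    and "mono (\<lambda>y. expectation (\<lambda>\<omega>. \<phi> (Z \<omega> + y)))"
    and "x \<le> y \<Longrightarrow> expectation (\<lambda>\<omega>. \<phi> (Z \<omega> + y)) - expectation (\<lambda>\<omega>. \<phi> (Z \<omega> + x)) \<le> L * (y - x)"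
proof -
  have int: "integrable M (\<lambda>\<omega>. \<phi> (Z \<omega> + y))" for y
  proof (rule integrable_bounded_mono_comp[OF mono])
    show "\<bar>Z \<omega> + y\<bar> \<le> \<bar>lo\<bar> + \<bar>hi\<bar> + \<bar>y\<bar>" if "\<omega> \<in> space M" for \<omega>
      using bd[OF that] by linarith
  qed measurable
  show "integrable M (\<lambda>\<omega>. \<phi> (Z \<omega> + y))" by (rule int)
  show "mono (\<lambda>y. expectation (\<lambda>\<omega>. \<phi> (Z \<omega> + y)))"
    by (intro monoI integral_mono int) (use mono in \<open>auto simp: mono_def\<close>)
  assume xy: "x \<le> y"
  have "expectation (\<lambda>\<omega>. \<phi> (Z \<omega> + y)) - expectation (\<lambda>\<omega>. \<phi> (Z \<omega> + x))
      = expectation (\<lambda>\<omega>. \<phi> (Z \<omega> + y) - \<phi> (Z \<omega> + x))"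
    using int by simp
  also have "\<dots> \<le> expectation (\<lambda>\<omega>. L * (y - x))"
  proof (rule integral_mono)
    show "\<phi> (Z \<omega> + y) - \<phi> (Z \<omega> + x) \<le> L * (y - x)" for \<omega>
      using Lip[of "Z \<omega> + x" "Z \<omega> + y"] xy by simp
  qed (use int in auto)
  finally show "expectation (\<lambda>\<omega>. \<phi> (Z \<omega> + y)) - expectation (\<lambda>\<omega>. \<phi> (Z \<omega> + x)) \<le> L * (y - x)"
    by (simp add: prob_space)
qed

text \<open>
  The inner expectation on the right is over an independent copy of \<open>Z\<close>. With \<open>Z\<close>
  rounded up to the grid, \<open>\<phi> (Z + R)\<close> is \<open>\<phi> (lo + R)\<close> plus a sum of products of an indicator
  \<open>1[lo + m h < Z]\<close> with the increment of \<open>\<phi>\<close> over one step of the grid, translated by \<open>R\<close>. The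
  increment takes values in \<open>[0, L h]\<close>, so separating one product costs at most \<open>\<alpha> L h\<close>, and the
  \<open>N\<close> steps together cost \<open>\<alpha> L (hi - lo)\<close>. The cost is thus governed by the slope of \<open>\<phi>\<close> and not
  by its maximum.
\<close>

lemma expectation_decouple_le:
  fixes \<phi> :: "real \<Rightarrow> real"
  assumes Z [measurable]: "Z \<in> borel_measurable M" and R [measurable]: "R \<in> borel_measurable M"
    and bd: "\<And>\<omega>. \<omega> \<in> space M \<Longrightarrow> lo \<le> Z \<omega> \<and> Z \<omega> \<le> hi"
    and bdR: "\<And>\<omega>. \<omega> \<in> space M \<Longrightarrow> \<bar>R \<omega>\<bar> \<le> K"
    and mono: "mono \<phi>" and Lip: "\<And>x y. x \<le> y \<Longrightarrow> \<phi> y - \<phi> x \<le> L * (y - x)" and L: "0 \<le> L"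
    and dep: "\<And>s A. A \<in> sets borel \<Longrightarrow>
      prob ({\<omega> \<in> space M. s < Z \<omega>} \<inter> {\<omega> \<in> space M. R \<omega> \<in> A})
        - prob {\<omega> \<in> space M. s < Z \<omega>} * prob {\<omega> \<in> space M. R \<omega> \<in> A} \<le> \<alpha>"
  shows "expectation (\<lambda>\<omega>. \<phi> (Z \<omega> + R \<omega>))
    \<le> expectation (\<lambda>\<omega>. expectation (\<lambda>\<omega>'. \<phi> (Z \<omega>' + R \<omega>))) + \<alpha> * L * (hi - lo)"
proof (rule field_le_epsilon)
  fix \<epsilon> :: real assume "0 < \<epsilon>"
  obtain \<omega>0 where "\<omega>0 \<in> space M" using not_empty by blast
  then have lohi: "lo \<le> hi" using bd[of \<omega>0] by simp
  obtain N where N: "L * (hi - lo) / \<epsilon> < real N" "0 < N"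
    using reals_Archimedean2[of "max (L * (hi - lo) / \<epsilon>) 0"] by auto
  define h where "h = (hi - lo) / real N"
  have h: "0 \<le> h" "real N * h = hi - lo" "L * h \<le> \<epsilon>"
    using lohi N \<open>0 < \<epsilon>\<close> by (auto simp: h_def field_simps)
  note phi_meas [measurable] = borel_measurable_mono[OF mono]
  define B where "B m = {\<omega> \<in> space M. lo + real m * h < Z \<omega>}" for m
  have B [measurable]: "B m \<in> events" for m unfolding B_def by measurable
  define \<Delta> where "\<Delta> m y = \<phi> (lo + real (Suc m) * h + y) - \<phi> (lo + real m * h + y)" for m y
  have \<Delta> [measurable]: "\<Delta> m \<in> borel_measurable borel" for m unfolding \<Delta>_def by measurable
  have \<Delta>_bd: "0 \<le> \<Delta> m y" "\<Delta> m y \<le> L * h" for m y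
    using mono Lip[of "lo + real m * h + y" "lo + real (Suc m) * h + y"] h(1)
    by (auto simp: \<Delta>_def mono_def algebra_simps)
  have stair: "\<phi> (Z \<omega> + y) \<le> \<phi> (lo + y) + (\<Sum>m<N. indicator (B m) \<omega> * \<Delta> m y)"
    "\<phi> (lo + y) + (\<Sum>m<N. indicator (B m) \<omega> * \<Delta> m y) \<le> \<phi> (Z \<omega> + y) + L * h"
    if w: "\<omega> \<in> space M" for \<omega> y
  proof -
    have eq: "(\<Sum>m<N. indicator (B m) \<omega> * \<Delta> m y) = (\<Sum>m<N. of_bool (lo + real m * h < Z \<omega>) *
        (\<phi> (lo + real (Suc m) * h + y) - \<phi> (lo + real m * h + y)))"
      using w by (intro sum.cong) (auto simp: B_def \<Delta>_def indicator_def)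
    have m: "mono (\<lambda>x. \<phi> (x + y))" using mono by (auto simp: mono_def)
    have l: "\<phi> (y' + y) - \<phi> (x + y) \<le> L * (y' - x)" if "x \<le> y'" for x y'
      using Lip[of "x + y" "y' + y"] that by simp
    have b: "lo \<le> Z \<omega>" "Z \<omega> \<le> lo + real N * h" using bd[OF w] h(2) by auto
    show "\<phi> (Z \<omega> + y) \<le> \<phi> (lo + y) + (\<Sum>m<N. indicator (B m) \<omega> * \<Delta> m y)"
      "\<phi> (lo + y) + (\<Sum>m<N. indicator (B m) \<omega> * \<Delta> m y) \<le> \<phi> (Z \<omega> + y) + L * h"
      unfolding eq by (rule staircase_bounds[OF h(1) b m l L]; assumption)+
  qed
  have int_lo: "integrable M (\<lambda>\<omega>. \<phi> (lo + R \<omega>))"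
  proof (rule integrable_bounded_mono_comp[OF mono])
    show "\<bar>lo + R \<omega>\<bar> \<le> \<bar>lo\<bar> + K" if "\<omega> \<in> space M" for \<omega>
      using bdR[OF that] by linarith
  qed measurable
  have int_ZR: "integrable M (\<lambda>\<omega>. \<phi> (Z \<omega> + R \<omega>))"
  proof (rule integrable_bounded_mono_comp[OF mono])
    show "\<bar>Z \<omega> + R \<omega>\<bar> \<le> \<bar>lo\<bar> + \<bar>hi\<bar> + K" if "\<omega> \<in> space M" for \<omega>
      using bdR[OF that] bd[OF that] by linarith
  qed measurable
  have int_B\<Delta>: "integrable M (\<lambda>\<omega>. indicator (B m) \<omega> * \<Delta> m (R \<omega>))" for m
    using \<Delta>_bd by (intro integrable_const_bound[where B = "L * h"] AE_I2)
      (auto simp: indicator_def h L)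
  have int_S: "integrable M (\<lambda>\<omega>. \<phi> (lo + R \<omega>) + (\<Sum>m<N. indicator (B m) \<omega> * \<Delta> m (R \<omega>)))"
    by (intro Bochner_Integration.integrable_add Bochner_Integration.integrable_sum int_lo int_B\<Delta>)
  have int_\<Delta>: "integrable M (\<lambda>\<omega>. \<Delta> m (R \<omega>))" for m
    using \<Delta>_bd by (intro integrable_const_bound[where B = "L * h"] AE_I2) auto
  note tr = translated_expectation[OF Z bd mono Lip]
  have int_\<psi>: "integrable M (\<lambda>\<omega>. expectation (\<lambda>\<omega>'. \<phi> (Z \<omega>' + R \<omega>)))"
    by (rule integrable_bounded_mono_comp[OF tr(2) R bdR])
  have \<psi>: "\<phi> (lo + y) + (\<Sum>m<N. prob (B m) * \<Delta> m y) \<le> expectation (\<lambda>\<omega>'. \<phi> (Z \<omega>' + y)) + L * h" for y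
  proof -
    have int: "integrable M (\<lambda>\<omega>. indicator (B m) \<omega> * \<Delta> m y)" for m
      by (intro integrable_mult_left) (auto simp: emeasure_eq_measure)
    have int_st: "integrable M (\<lambda>\<omega>. \<phi> (lo + y) + (\<Sum>m<N. indicator (B m) \<omega> * \<Delta> m y))"
      by (intro Bochner_Integration.integrable_add Bochner_Integration.integrable_sum int) simp
    have "\<phi> (lo + y) + (\<Sum>m<N. prob (B m) * \<Delta> m y)
      = expectation (\<lambda>\<omega>. \<phi> (lo + y) + (\<Sum>m<N. indicator (B m) \<omega> * \<Delta> m y))"
      by (subst Bochner_Integration.integral_add, simp,
          rule Bochner_Integration.integrable_sum, rule int,
          subst Bochner_Integration.integral_sum, rule int) (simp add: prob_space)
    also have "\<dots> \<le> expectation (\<lambda>\<omega>. \<phi> (Z \<omega> + y) + L * h)"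
      by (rule integral_mono[OF int_st _ stair(2)]) (use tr(1) in auto)
    also have "\<dots> = expectation (\<lambda>\<omega>'. \<phi> (Z \<omega>' + y)) + L * h"
      using tr(1) by (simp add: prob_space)
    finally show ?thesis .
  qed
  have cov: "expectation (\<lambda>\<omega>. indicator (B m) \<omega> * \<Delta> m (R \<omega>))
      \<le> prob (B m) * expectation (\<lambda>\<omega>. \<Delta> m (R \<omega>)) + \<alpha> * (L * h)" for m
  proof (rule covariance_event_bounded_le)
    fix s
    have "{y. s < \<Delta> m y} \<in> sets borel" by measurable
    from dep[OF this, of "lo + real m * h"]
    show "prob (B m \<inter> {\<omega> \<in> space M. s < \<Delta> m (R \<omega>)})
        - prob (B m) * prob {\<omega> \<in> space M. s < \<Delta> m (R \<omega>)} \<le> \<alpha>"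
      by (simp add: B_def)
  qed (use \<Delta>_bd in auto)
  have "expectation (\<lambda>\<omega>. \<phi> (Z \<omega> + R \<omega>))
      \<le> expectation (\<lambda>\<omega>. \<phi> (lo + R \<omega>) + (\<Sum>m<N. indicator (B m) \<omega> * \<Delta> m (R \<omega>)))"
    by (rule integral_mono[OF int_ZR int_S stair(1)])
  also have "\<dots> = expectation (\<lambda>\<omega>. \<phi> (lo + R \<omega>))
      + (\<Sum>m<N. expectation (\<lambda>\<omega>. indicator (B m) \<omega> * \<Delta> m (R \<omega>)))"
    by (subst Bochner_Integration.integral_add, rule int_lo,
        rule Bochner_Integration.integrable_sum, rule int_B\<Delta>,
        subst Bochner_Integration.integral_sum, rule int_B\<Delta>) simp
  also have "\<dots> \<le> expectation (\<lambda>\<omega>. \<phi> (lo + R \<omega>))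
      + (\<Sum>m<N. prob (B m) * expectation (\<lambda>\<omega>. \<Delta> m (R \<omega>)) + \<alpha> * (L * h))"
    by (intro add_left_mono sum_mono cov)
  also have "\<dots> = expectation (\<lambda>\<omega>. \<phi> (lo + R \<omega>) + (\<Sum>m<N. prob (B m) * \<Delta> m (R \<omega>)))
      + \<alpha> * L * (real N * h)"
    using int_lo int_\<Delta> by (simp add: Bochner_Integration.integral_sum sum.distrib)
  also have "\<dots> \<le> expectation (\<lambda>\<omega>. expectation (\<lambda>\<omega>'. \<phi> (Z \<omega>' + R \<omega>)) + L * h)
      + \<alpha> * L * (real N * h)"
    using int_lo int_\<Delta> int_\<psi> \<psi> by (intro add_right_mono integral_mono) auto
  also have "\<dots> = expectation (\<lambda>\<omega>. expectation (\<lambda>\<omega>'. \<phi> (Z \<omega>' + R \<omega>))) + L * h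
      + \<alpha> * L * (hi - lo)"
    using int_\<psi> h(2) by (simp add: prob_space)
  finally show "expectation (\<lambda>\<omega>. \<phi> (Z \<omega> + R \<omega>))
      \<le> expectation (\<lambda>\<omega>. expectation (\<lambda>\<omega>'. \<phi> (Z \<omega>' + R \<omega>))) + \<alpha> * L * (hi - lo) + \<epsilon>"
    using h(3) by linarith
qed

text \<open>
  Hoeffding's lemma, restated for the Bochner integral.
\<close>

lemma mgf_centered_bounded_le:
  fixes Z :: "'a \<Rightarrow> real"
  assumes Z [measurable]: "Z \<in> borel_measurable M"
    and bd: "\<And>\<omega>. \<omega> \<in> space M \<Longrightarrow> lo \<le> Z \<omega> \<and> Z \<omega> \<le> hi"
    and "expectation Z = 0" and "0 < v"
  shows "integrable M (\<lambda>\<omega>. exp (v * Z \<omega>))"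
    and "expectation (\<lambda>\<omega>. exp (v * Z \<omega>)) \<le> exp (v\<^sup>2 * (hi - lo)\<^sup>2 / 8)"
proof -
  interpret interval_bounded_random_variable M Z lo hi
    by unfold_locales (use bd in auto)
  have "mono (\<lambda>z. exp (v * z))" using \<open>0 < v\<close> by (auto simp: mono_def)
  then show int: "integrable M (\<lambda>\<omega>. exp (v * Z \<omega>))"
  proof (rule integrable_bounded_mono_comp)
    show "\<bar>Z \<omega>\<bar> \<le> \<bar>lo\<bar> + \<bar>hi\<bar>" if "\<omega> \<in> space M" for \<omega>
      using bd[OF that] by linarith
  qed measurable
  show "expectation (\<lambda>\<omega>. exp (v * Z \<omega>)) \<le> exp (v\<^sup>2 * (hi - lo)\<^sup>2 / 8)"
    using Hoeffdings_lemma_nn_integral_0[OF \<open>0 < v\<close> assms(3)] int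
    by (subst (asm) nn_integral_eq_integral) auto
qed

end

section \<open>Sums along an ordering\<close>

lemma generated_sigma_empty: "generated_sigma M X {} = {{}, space M}"
  by (simp add: generated_sigma_def sigma_sets_empty_eq)

lemma generated_sigma_subset_Pow: "generated_sigma M X I \<subseteq> Pow (space M)"
  unfolding generated_sigma_def by (auto dest: sigma_sets_into_sp[rotated])

lemma generated_sigma_subset_sets:
  assumes "\<And>i. i \<in> I \<Longrightarrow> X i \<in> borel_measurable M"
  shows "generated_sigma M X I \<subseteq> sets M"
  unfolding generated_sigma_def
  by (intro sets.sigma_sets_subset) (use assms in \<open>auto intro: measurable_sets\<close>)

text \<open>
  Level sets of the partial sums are among the events over which the dependence coefficient takes its
  supremum.
\<close>

lemma sum_list_level_set_in_generated_sigma: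
  fixes X g :: "_ \<Rightarrow> _ \<Rightarrow> real"
  assumes "\<And>i. i \<in> I \<Longrightarrow> g i \<in> borel_measurable borel" "set xs \<subseteq> I" "A \<in> sets borel"
  shows "{\<omega> \<in> space M. (\<Sum>i\<leftarrow>xs. g i (X i \<omega>)) \<in> A} \<in> generated_sigma M X I"
proof -
  define G where "G = (\<Union>i\<in>I. {X i -` A \<inter> space M | A. A \<in> sets borel})"
  define N where "N = sigma (space M) G"
  have G: "G \<subseteq> Pow (space M)" by (auto simp: G_def)
  have N: "space N = space M" "sets N = generated_sigma M X I"
    using G by (simp_all add: N_def generated_sigma_def G_def)
  have X: "X i \<in> borel_measurable N" if "i \<in> I" for i
  proof (rule measurableI)
    fix A :: "real set" assume "A \<in> sets borel"
    then have "X i -` A \<inter> space M \<in> G" using that by (auto simp: G_def)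
    then show "X i -` A \<inter> space N \<in> sets N" unfolding N(1) by (simp add: N_def G)
  qed simp
  have "(\<lambda>\<omega>. \<Sum>i\<leftarrow>xs. g i (X i \<omega>)) \<in> borel_measurable N"
    using assms(2)
  proof (induction xs)
    case (Cons i xs)
    have "(\<lambda>\<omega>. g i (X i \<omega>)) \<in> borel_measurable N"
      using measurable_compose[OF X assms(1)] Cons.prems by auto
    with Cons show ?case by simp
  qed simp
  then have "{\<omega> \<in> space N. (\<Sum>i\<leftarrow>xs. g i (X i \<omega>)) \<in> A} \<in> sets N"
    using assms(3) by measurable
  then show ?thesis by (simp add: N)
qed

context prob_space
begin

lemma covariance_le_alpha_coeff:
  assumes "B \<in> \<B>" "C \<in> \<C>"
  shows "\<bar>prob (B \<inter> C) - prob B * prob C\<bar> \<le> alpha_coeff M \<B> \<C>"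
proof -
  have bd: "\<bar>prob (B \<inter> C) - prob B * prob C\<bar> \<le> 1" for B C
  proof -
    have "prob B * prob C \<le> 1 * 1" by (intro mult_mono) auto
    moreover have "0 \<le> prob B * prob C" by simp
    ultimately show ?thesis
      using prob_le_1[of "B \<inter> C"] measure_nonneg[of M "B \<inter> C"] unfolding abs_le_iff by linarith
  qed
  have "bdd_above ((\<lambda>(B, C). \<bar>prob (B \<inter> C) - prob B * prob C\<bar>) ` (\<B> \<times> \<C>))"
    by (rule bdd_aboveI[where M = 1]) (use bd in auto)
  from cSUP_upper[OF _ this, of "(B, C)"] show ?thesis using assms
    by (simp add: alpha_coeff_def)
qed

lemma alpha_rv_nonneg: "0 \<le> alpha_rv M X I J"
proof -
  have "{} \<in> generated_sigma M X K" for K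
    by (simp add: generated_sigma_def sigma_sets.Empty)
  from covariance_le_alpha_coeff[OF this this] show ?thesis
    by (simp add: alpha_rv_def)
qed

text \<open>
  With this the coefficients can be summed over all positions of an ordering: the last position has an
  empty tail and contributes nothing.
\<close>

lemma alpha_rv_empty_right: "alpha_rv M X I {} = 0"
proof -
  have ne: "generated_sigma M X I \<noteq> {}"
    by (auto simp: generated_sigma_def intro: sigma_sets.Empty)
  have "alpha_rv M X I {} = (SUP (B, C)\<in>generated_sigma M X I \<times> {{}, space M}. 0)"
    unfolding alpha_rv_def alpha_coeff_def generated_sigma_empty
  proof (rule SUP_cong[OF refl], clarify)
    fix B C assume "B \<in> generated_sigma M X I" "C \<in> {{}, space M}"
    moreover from this have "B \<inter> space M = B"
      using generated_sigma_subset_Pow[of M X I] by auto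
    ultimately show "\<bar>prob (B \<inter> C) - prob B * prob C\<bar> = 0" by (auto simp: prob_space)
  qed
  also have "\<dots> = 0" using ne by (simp add: case_prod_beta')
  finally show ?thesis .
qed

text \<open>
  The variables are replaced by independent copies one at a time, starting from the head of the list.
  The head \<open>Z\<close> is decoupled from the sum \<open>R\<close> of the tail, and averaging over its copy produces a new
  test function \<open>\<psi>\<close> to which the induction hypothesis applies: \<open>\<psi>\<close> has the same Lipschitz constant
  \<open>L\<close>, and by Hoeffding's lemma its exponential majorant grows by the factor
  \<open>exp (v\<^sup>2 (hi - lo)\<^sup>2 / 8)\<close>. Copies of the variables therefore never have to be constructed.
\<close>

lemma expectation_sum_list_le:
  fixes X g :: "'i \<Rightarrow> _ \<Rightarrow> real" and \<phi> :: "real \<Rightarrow> real"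
  assumes X: "\<And>i. i \<in> set xs \<Longrightarrow> X i \<in> borel_measurable M"
    and g: "\<And>i. i \<in> set xs \<Longrightarrow> g i \<in> borel_measurable borel"
    and bd: "\<And>i x. i \<in> set xs \<Longrightarrow> lo i \<le> g i x \<and> g i x \<le> hi i"
    and E0: "\<And>i. i \<in> set xs \<Longrightarrow> expectation (\<lambda>\<omega>. g i (X i \<omega>)) = 0"
    and mono: "mono \<phi>" and Lip: "\<And>x y. x \<le> y \<Longrightarrow> \<phi> y - \<phi> x \<le> L * (y - x)" and L: "0 \<le> L"
    and exp: "\<And>y. \<phi> y \<le> A * exp (v * y)" and v: "0 < v" and A: "0 \<le> A"
  shows "expectation (\<lambda>\<omega>. \<phi> (\<Sum>i\<leftarrow>xs. g i (X i \<omega>)))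
    \<le> A * exp (v\<^sup>2 * (\<Sum>i\<leftarrow>xs. (hi i - lo i)\<^sup>2) / 8)
      + L * (\<Sum>m<length xs. (hi (xs ! m) - lo (xs ! m)) * alpha_rv M X {xs ! m} (set (drop (Suc m) xs)))"
  using X g bd E0 mono Lip exp A
proof (induction xs arbitrary: \<phi> A)
  case Nil
  then show ?case using Nil(7)[of 0] by (simp add: prob_space)
next
  case (Cons i xs)
  define Z where "Z \<omega> = g i (X i \<omega>)" for \<omega>
  define R where "R \<omega> = (\<Sum>i\<leftarrow>xs. g i (X i \<omega>))" for \<omega>
  define \<psi> where "\<psi> y = expectation (\<lambda>\<omega>. \<phi> (Z \<omega> + y))" for y
  \<comment> \<open>the majorant after averaging over the copy of the head\<close>
  define A' where "A' = A * exp (v\<^sup>2 * (hi i - lo i)\<^sup>2 / 8)"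
  note prems = Cons.prems
  have Z [measurable]: "Z \<in> borel_measurable M"
    unfolding Z_def using prems(1,2) by (auto intro: measurable_compose)
  have Zbd: "lo i \<le> Z \<omega> \<and> Z \<omega> \<le> hi i" for \<omega> using prems(3) by (simp add: Z_def)
  have R_gen: "{\<omega> \<in> space M. R \<omega> \<in> B} \<in> generated_sigma M X (set xs)" if "B \<in> sets borel" for B
    unfolding R_def by (rule sum_list_level_set_in_generated_sigma) (use prems(2) that in auto)
  have "generated_sigma M X (set xs) \<subseteq> events"
    by (rule generated_sigma_subset_sets) (use prems(1) in auto)
  then have R [measurable]: "R \<in> borel_measurable M"
    using R_gen by (intro measurableI) (auto simp: vimage_def Int_def conj_commute)
  have Rbd: "\<bar>R \<omega>\<bar> \<le> (\<Sum>i\<leftarrow>xs. \<bar>lo i\<bar> + \<bar>hi i\<bar>)" for \<omega>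
  proof -
    have "\<bar>R \<omega>\<bar> \<le> (\<Sum>i\<leftarrow>xs. \<bar>g i (X i \<omega>)\<bar>)"
      unfolding R_def using sum_list_abs[of "map (\<lambda>i. g i (X i \<omega>)) xs"] by (simp add: o_def)
    also have "\<dots> \<le> (\<Sum>i\<leftarrow>xs. \<bar>lo i\<bar> + \<bar>hi i\<bar>)"
    proof (rule sum_list_mono)
      fix k assume "k \<in> set xs"
      then show "\<bar>g k (X k \<omega>)\<bar> \<le> \<bar>lo k\<bar> + \<bar>hi k\<bar>" using prems(3)[of k "X k \<omega>"] by auto
    qed
    finally show ?thesis .
  qed
  have dep: "prob ({\<omega> \<in> space M. s < Z \<omega>} \<inter> {\<omega> \<in> space M. R \<omega> \<in> B})
        - prob {\<omega> \<in> space M. s < Z \<omega>} * prob {\<omega> \<in> space M. R \<omega> \<in> B}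
      \<le> alpha_rv M X {i} (set xs)" if "B \<in> sets borel" for s B
  proof -
    have "{\<omega> \<in> space M. (\<Sum>i\<leftarrow>[i]. g i (X i \<omega>)) \<in> {s<..}} \<in> generated_sigma M X {i}"
      by (rule sum_list_level_set_in_generated_sigma) (use prems(2) in auto)
    then have "{\<omega> \<in> space M. s < Z \<omega>} \<in> generated_sigma M X {i}" by (simp add: Z_def)
    from covariance_le_alpha_coeff[OF this R_gen[OF that]] show ?thesis
      by (simp add: alpha_rv_def)
  qed
  note tr = translated_expectation[OF Z Zbd prems(5,6), folded \<psi>_def]
  have \<psi>_exp: "\<psi> y \<le> A' * exp (v * y)" for y
  proof -
    have EZ: "expectation Z = 0" using prems(4)[of i] unfolding Z_def by simp
    note mgf = mgf_centered_bounded_le[OF Z Zbd EZ v]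
    have "\<psi> y \<le> expectation (\<lambda>\<omega>. (A * exp (v * y)) * exp (v * Z \<omega>))"
      unfolding \<psi>_def
    proof (rule integral_mono)
      show "\<phi> (Z \<omega> + y) \<le> A * exp (v * y) * exp (v * Z \<omega>)" for \<omega>
        using prems(7)[of "Z \<omega> + y"] by (simp add: algebra_simps exp_add)
    qed (use mgf(1) tr(1) in auto)
    also have "\<dots> = (A * exp (v * y)) * expectation (\<lambda>\<omega>. exp (v * Z \<omega>))" by simp
    also have "\<dots> \<le> (A * exp (v * y)) * exp (v\<^sup>2 * (hi i - lo i)\<^sup>2 / 8)"
      using mgf(2) prems(8) by (intro mult_left_mono) auto
    finally show ?thesis by (simp add: A'_def mult_ac)
  qed
  have "expectation (\<lambda>\<omega>. \<phi> (\<Sum>i\<leftarrow>i # xs. g i (X i \<omega>))) = expectation (\<lambda>\<omega>. \<phi> (Z \<omega> + R \<omega>))"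
    by (simp add: Z_def R_def)
  also have "\<dots> \<le> expectation (\<lambda>\<omega>. \<psi> (R \<omega>)) + alpha_rv M X {i} (set xs) * L * (hi i - lo i)"
    unfolding \<psi>_def by (rule expectation_decouple_le[OF Z R Zbd Rbd prems(5,6) L dep])
  also have "expectation (\<lambda>\<omega>. \<psi> (R \<omega>)) \<le> A' * exp (v\<^sup>2 * (\<Sum>i\<leftarrow>xs. (hi i - lo i)\<^sup>2) / 8)
      + L * (\<Sum>m<length xs. (hi (xs ! m) - lo (xs ! m)) * alpha_rv M X {xs ! m} (set (drop (Suc m) xs)))"
    unfolding R_def
    by (rule Cons.IH) (use prems tr \<psi>_exp in \<open>auto simp: A'_def\<close>)
  also have "A' * exp (v\<^sup>2 * (\<Sum>i\<leftarrow>xs. (hi i - lo i)\<^sup>2) / 8)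
      = A * exp (v\<^sup>2 * (\<Sum>i\<leftarrow>i # xs. (hi i - lo i)\<^sup>2) / 8)"
    by (simp add: A'_def mult.assoc add_divide_distrib distrib_left flip: exp_add)
  finally show ?case
    by (simp add: sum.lessThan_Suc_shift algebra_simps del: sum.lessThan_Suc)
qed

lemma gamma_independent_ordering:
  assumes "finite I" "gamma_independent M X \<gamma> I"
  obtains xs where "distinct xs" "set xs = I"
    "(\<Sum>m<length xs. alpha_rv M X {xs ! m} (set (drop (Suc m) xs))) \<le> real (card I) * \<gamma>"
proof -
  define F where "F xs = (1 / real (card I)) *
        (\<Sum>i<card I - 1. alpha_rv M X {xs ! i} ((\<lambda>j. xs ! j) ` {i + 1..<card I}))" for xs
  have "Min (F ` permutations_of_set I) \<in> F ` permutations_of_set I"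
    using assms(1) by (intro Min_in) auto
  moreover have "Min (F ` permutations_of_set I) \<le> \<gamma>"
    using assms(2) by (simp add: gamma_independent_def alpha_separation_def F_def)
  ultimately obtain xs where xs: "xs \<in> permutations_of_set I" "F xs \<le> \<gamma>" by auto
  have d: "distinct xs" "set xs = I" using xs(1) by (auto dest: permutations_of_setD)
  then have len: "length xs = card I" using distinct_card by fastforce
  have tail: "(\<lambda>j. xs ! j) ` {m + 1..<length xs} = set (drop (Suc m) xs)" for m
  proof -
    have "{m + 1..<length xs} = (\<lambda>j. Suc m + j) ` {..<length (drop (Suc m) xs)}"
    proof (intro equalityI subsetI)
      fix x assume "x \<in> {m + 1..<length xs}"
      then show "x \<in> (\<lambda>j. Suc m + j) ` {..<length (drop (Suc m) xs)}"
        by (intro image_eqI[of _ _ "x - Suc m"]) auto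
    qed auto
    then have "(\<lambda>j. xs ! j) ` {m + 1..<length xs} = (\<lambda>j. drop (Suc m) xs ! j) ` {..<length (drop (Suc m) xs)}"
      by (auto simp: image_image)
    also have "\<dots> = set (drop (Suc m) xs)" by (auto simp: set_conv_nth)
    finally show ?thesis .
  qed
  show ?thesis
  proof (rule that[OF d])
    show "(\<Sum>m<length xs. alpha_rv M X {xs ! m} (set (drop (Suc m) xs))) \<le> real (card I) * \<gamma>"
    proof (cases xs)
      case Nil
      then show ?thesis using d by simp
    next
      case (Cons x ys)
      then have k: "length xs = Suc (card I - 1)" using len by simp
      then have last: "drop (Suc (card I - 1)) xs = []" by simp
      have "(\<Sum>m<length xs. alpha_rv M X {xs ! m} (set (drop (Suc m) xs)))
          = (\<Sum>m<card I - 1. alpha_rv M X {xs ! m} (set (drop (Suc m) xs)))"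
        unfolding k using last by (simp add: alpha_rv_empty_right)
      also have "\<dots> = real (card I) * F xs"
      proof -
        have "real (card I) \<noteq> 0" using Cons len by auto
        moreover have "(\<lambda>j. xs ! j) ` {m + 1..<card I} = set (drop (Suc m) xs)" for m
          using tail[of m] len by simp
        ultimately show ?thesis unfolding F_def by simp
      qed
      also have "\<dots> \<le> real (card I) * \<gamma>" using xs(2) by (intro mult_left_mono) auto
      finally show ?thesis .
    qed
  qed
qed

text \<open>
  The dependence error \<open>\<Sum> d i \<alpha> i\<close> along a good ordering is bounded in two ways, since both each
  single \<open>\<alpha> i\<close> and their sum are at most \<open>K\<close>. Neither bound suffices alone: when the errors of the
  classes of a cover are added up, the first one gives the total width of the variables, however often
  they are covered, and the second one gives the largest width times the total weight.
\<close>

lemma expectation_class_sum_le: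
  fixes X g :: "'i \<Rightarrow> _ \<Rightarrow> real" and \<phi> :: "real \<Rightarrow> real"
  assumes I: "finite I" "gamma_independent M X \<gamma> I" "real (card I) * \<gamma> \<le> K"
    and X: "\<And>i. i \<in> I \<Longrightarrow> X i \<in> borel_measurable M"
    and g: "\<And>i. i \<in> I \<Longrightarrow> g i \<in> borel_measurable borel"
    and bd: "\<And>i x. i \<in> I \<Longrightarrow> lo i \<le> g i x \<and> g i x \<le> hi i"
    and E0: "\<And>i. i \<in> I \<Longrightarrow> expectation (\<lambda>\<omega>. g i (X i \<omega>)) = 0"
    and d: "\<And>i. i \<in> I \<Longrightarrow> hi i - lo i = d i \<and> 0 \<le> d i \<and> d i \<le> r" and r: "0 \<le> r"
    and mono: "mono \<phi>" and Lip: "\<And>x y. x \<le> y \<Longrightarrow> \<phi> y - \<phi> x \<le> L * (y - x)" and L: "0 \<le> L"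
    and exp: "\<And>y. \<phi> y \<le> A * exp (v * y)" and v: "0 < v" and A: "0 \<le> A"
  shows "expectation (\<lambda>\<omega>. \<phi> (\<Sum>i\<in>I. g i (X i \<omega>)))
    \<le> A * exp (v\<^sup>2 * (\<Sum>i\<in>I. (d i)\<^sup>2) / 8) + L * (K * min (\<Sum>i\<in>I. d i) r)"
proof -
  obtain xs where xs: "distinct xs" "set xs = I"
    "(\<Sum>m<length xs. alpha_rv M X {xs ! m} (set (drop (Suc m) xs))) \<le> real (card I) * \<gamma>"
    by (rule gamma_independent_ordering[OF I(1,2)])
  define \<alpha> where "\<alpha> m = alpha_rv M X {xs ! m} (set (drop (Suc m) xs))" for m
  have \<alpha>0: "0 \<le> \<alpha> m" for m by (simp add: \<alpha>_def alpha_rv_nonneg)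
  have \<alpha>K: "(\<Sum>m<length xs. \<alpha> m) \<le> K" using xs(3) I(3) by (simp add: \<alpha>_def)
  have \<alpha>1: "\<alpha> m \<le> K" if "m < length xs" for m
    using member_le_sum[of m "{..<length xs}" \<alpha>] that \<alpha>0 \<alpha>K by auto
  have dm: "0 \<le> d (xs ! m) \<and> d (xs ! m) \<le> r" if "m < length xs" for m
    using d[of "xs ! m"] xs(2) that by auto
  have K0: "0 \<le> K" using order_trans[OF sum_nonneg \<alpha>K] \<alpha>0 by auto
  have sl: "(\<Sum>i\<leftarrow>xs. f i) = (\<Sum>i\<in>I. f i)" for f :: "'i \<Rightarrow> real"
    using xs(1,2) by (metis sum_list_distinct_conv_sum_set)
  have "(\<Sum>m<length xs. d (xs ! m) * \<alpha> m) \<le> (\<Sum>m<length xs. r * \<alpha> m)"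
    using dm \<alpha>0 by (intro sum_mono mult_right_mono) auto
  also have "\<dots> \<le> K * r"
    using \<alpha>K r by (simp add: mult.commute[of K] mult_left_mono flip: sum_distrib_left)
  finally have e1: "(\<Sum>m<length xs. d (xs ! m) * \<alpha> m) \<le> K * r" .
  have "(\<Sum>m<length xs. d (xs ! m) * \<alpha> m) \<le> (\<Sum>m<length xs. d (xs ! m) * K)"
    using dm \<alpha>1 by (intro sum_mono mult_left_mono) auto
  also have "\<dots> = K * (\<Sum>i\<leftarrow>xs. d i)"
    by (simp add: sum_list_sum_nth atLeast0LessThan sum_distrib_left mult.commute)
  finally have e2: "(\<Sum>m<length xs. d (xs ! m) * \<alpha> m) \<le> K * (\<Sum>i\<in>I. d i)" by (simp add: sl)
  have e: "(\<Sum>m<length xs. d (xs ! m) * \<alpha> m) \<le> K * min (\<Sum>i\<in>I. d i) r"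
    using e1 e2 by (simp add: min_def)
  have "expectation (\<lambda>\<omega>. \<phi> (\<Sum>i\<in>I. g i (X i \<omega>))) = expectation (\<lambda>\<omega>. \<phi> (\<Sum>i\<leftarrow>xs. g i (X i \<omega>)))"
    by (simp add: sl)
  also have "\<dots> \<le> A * exp (v\<^sup>2 * (\<Sum>i\<leftarrow>xs. (hi i - lo i)\<^sup>2) / 8)
      + L * (\<Sum>m<length xs. (hi (xs ! m) - lo (xs ! m)) * alpha_rv M X {xs ! m} (set (drop (Suc m) xs)))"
    by (rule expectation_sum_list_le) (use X g bd E0 mono Lip L exp v A xs(2) in auto)
  also have "(\<Sum>i\<leftarrow>xs. (hi i - lo i)\<^sup>2) = (\<Sum>i\<in>I. (d i)\<^sup>2)"
    unfolding sl using d by (intro sum.cong) auto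
  also have "(\<Sum>m<length xs. (hi (xs ! m) - lo (xs ! m)) * alpha_rv M X {xs ! m} (set (drop (Suc m) xs)))
      = (\<Sum>m<length xs. d (xs ! m) * \<alpha> m)"
    using d xs(2) by (intro sum.cong) (auto simp: \<alpha>_def)
  finally show ?thesis using mult_left_mono[OF e L] by linarith
qed

end

section \<open>Combining the classes of a cover\<close>

lemma weighted_cover_sum:
  fixes f w :: "nat \<Rightarrow> real"
  assumes "finite J" "\<And>j. j \<in> J \<Longrightarrow> I j \<subseteq> {1..n}"
  shows "(\<Sum>j\<in>J. w j * (\<Sum>i\<in>I j. f i)) = (\<Sum>i=1..n. (\<Sum>j\<in>{j\<in>J. i \<in> I j}. w j) * f i)"
proof -
  have "(\<Sum>j\<in>J. w j * (\<Sum>i\<in>I j. f i)) = (\<Sum>j\<in>J. \<Sum>i\<in>{i\<in>{1..n}. i \<in> I j}. w j * f i)"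
  proof (rule sum.cong[OF refl])
    fix j assume "j \<in> J"
    then have "{i \<in> {1..n}. i \<in> I j} = I j" using assms(2) by blast
    then show "w j * (\<Sum>i\<in>I j. f i) = (\<Sum>i\<in>{i\<in>{1..n}. i \<in> I j}. w j * f i)"
      by (simp add: sum_distrib_left)
  qed
  also have "\<dots> = (\<Sum>i=1..n. \<Sum>j\<in>{j\<in>J. i \<in> I j}. w j * f i)"
    by (rule sum.swap_restrict) (use assms(1) in auto)
  finally show ?thesis by (simp add: sum_distrib_right)
qed

text \<open>
  The first factor is the slope of the test function and the second one the accumulated dependence
  error. With \<open>y = \<tau>\<^sup>2 / (W s)\<close> the slope is \<open>(2 / \<tau>) y / (1 + y)\<close>. Using the bound \<open>D\<close> for three
  of four factors and the bound \<open>r W\<close> for the fourth gives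
  \<open>(min D (r W)) ^ 4 \<le> (N s) (N r) (r W)\<close>; the powers of \<open>W s\<close> then combine with the slope to
  \<open>y ^ 3 / (1 + y) ^ 4 \<le> 1\<close>, and \<open>W\<close> and \<open>s\<close> disappear.
\<close>

lemma truncation_error_le:
  fixes N \<tau> W s r D :: real
  assumes "0 < \<tau>" "0 < W" "0 < s" "0 \<le> r" "0 \<le> N" "0 \<le> D" "D\<^sup>2 \<le> N * s" "D \<le> N * r"
  defines "v \<equiv> 2 * \<tau> / (W * s)"
  shows "v / (1 + v * \<tau> / 2) * min D (r * W) \<le> 2 * sqrt (N * r / \<tau>)"
proof (rule power_le_imp_le_base[where n = 3])
  define y where "y = \<tau>\<^sup>2 / (W * s)"
  have y: "0 < y" using assms by (simp add: y_def)
  define m where "m = min D (r * W)"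
  have m: "0 \<le> m" "m \<le> D" "m \<le> r * W" using assms by (auto simp: m_def)
  have "m ^ 4 = m\<^sup>2 * m * m" by (simp add: power2_eq_square power4_eq_xxxx)
  also have "\<dots> \<le> (N * s) * (N * r) * (r * W)"
    using m assms order_trans[OF power_mono[OF m(2,1), of 2] assms(7)]
    by (intro mult_mono) auto
  finally have m4: "m ^ 4 \<le> N\<^sup>2 * r\<^sup>2 * (W * s)" by (simp add: power2_eq_square mult_ac)
  have slope: "v / (1 + v * \<tau> / 2) = 2 / \<tau> * (y / (1 + y))"
    using assms by (simp add: v_def y_def field_simps power2_eq_square)
  have "y ^ 3 \<le> (1 + y) ^ 3" using y by (intro power_mono) auto
  also have "\<dots> \<le> (1 + y) ^ 4" using y by (intro power_increasing) auto
  finally have y34: "y ^ 3 / (1 + y) ^ 4 \<le> 1" using y by simp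
  have "(v / (1 + v * \<tau> / 2) * min D (r * W)) ^ Suc 3 = 16 / \<tau> ^ 4 * (y ^ 4 / (1 + y) ^ 4) * m ^ 4"
    unfolding slope m_def by (simp add: power_mult_distrib power_divide)
  also have "\<dots> \<le> 16 / \<tau> ^ 4 * (y ^ 4 / (1 + y) ^ 4) * (N\<^sup>2 * r\<^sup>2 * (W * s))"
    using y assms by (intro mult_left_mono m4) auto
  also have "W * s = \<tau>\<^sup>2 / y" using assms by (simp add: y_def)
  also have "16 / \<tau> ^ 4 * (y ^ 4 / (1 + y) ^ 4) * (N\<^sup>2 * r\<^sup>2 * (\<tau>\<^sup>2 / y))
      = 16 * (N * r / \<tau>)\<^sup>2 * (y ^ 3 / (1 + y) ^ 4)"
  proof -
    have "y ^ 4 = y ^ 3 * y" "\<tau> ^ 4 = \<tau>\<^sup>2 * \<tau>\<^sup>2"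
      by (simp_all add: power3_eq_cube power4_eq_xxxx power2_eq_square)
    then show ?thesis using y \<open>0 < \<tau>\<close> by (simp add: power_mult_distrib power_divide field_simps)
  qed
  also have "\<dots> \<le> 16 * (N * r / \<tau>)\<^sup>2 * 1" by (intro mult_left_mono y34) auto
  also have "\<dots> = (2 * sqrt (N * r / \<tau>)) ^ Suc 3"
  proof -
    have "sqrt (N * r / \<tau>) ^ 4 = ((sqrt (N * r / \<tau>))\<^sup>2)\<^sup>2" by (simp flip: power_mult)
    then show ?thesis using assms by (simp add: power_mult_distrib)
  qed
  finally show "(v / (1 + v * \<tau> / 2) * min D (r * W)) ^ Suc 3 \<le> (2 * sqrt (N * r / \<tau>)) ^ Suc 3" .
qed (use assms in auto)

lemma fractional_cover_total_ge_1:
  assumes "fractional_cover n J I w" "1 \<le> n"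
  shows "1 \<le> (\<Sum>j\<in>J. w j)"
proof -
  have "1 \<le> (\<Sum>j\<in>{j\<in>J. 1 \<in> I j}. w j)" using assms by (auto simp: fractional_cover_def)
  also have "\<dots> \<le> (\<Sum>j\<in>J. w j)"
    using assms by (intro sum_mono2) (auto simp: fractional_cover_def)
  finally show ?thesis .
qed

context prob_space
begin

text \<open>
  Let \<open>\<mu> i \<ge> 1\<close> be the weight with which the cover meets \<open>i\<close>. Dividing the \<open>i\<close>-th variable by
  \<open>\<mu> i\<close> makes the sum \<open>S\<close> equal to \<open>\<Sum> w j * Y j\<close>, where \<open>Y j\<close> is the sum over the \<open>j\<close>-th class.
  As in Janson's inequality, \<open>S\<close> is a convex combination of the variables \<open>\<kappa> j * Y j\<close> with weights
  \<open>p j\<close> proportional to \<open>w j * sqrt (q j)\<close>, where \<open>q j\<close> is the sum of squared widths in the class;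
  then in every \<open>\<kappa> j * Y j\<close> the squared widths add up to the same \<open>Q\<^sup>2 \<le> W s\<close>.

  The test function is \<open>A * exp_linear (v * (x - c))\<close> with \<open>c = \<tau> / 2\<close> and \<open>v = 2 \<tau> / (W s)\<close>; the
  factor \<open>A \<le> 1\<close> is chosen so that its linear part reaches the value \<open>1\<close> at \<open>\<tau>\<close>. The exponential
  estimate at the level \<open>\<tau> / 2\<close> gives \<open>-(\<tau> / 2)\<^sup>2 * 2 / (W s) = -\<tau>\<^sup>2 / (2 W s)\<close>, which is the
  exponent claimed, while the slope is only \<open>A v\<close>. In the error terms \<open>p j * \<kappa> j = w j\<close>, so they add
  up with the weights of the cover.
\<close>

lemma soft_cover_tail_bound_centered:
  fixes X g :: "nat \<Rightarrow> _ \<Rightarrow> real" and d w :: "nat \<Rightarrow> real"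
  assumes cover: "soft_fractional_cover M X n \<gamma> J I w" and n: "1 \<le> n" and \<gamma>: "0 \<le> \<gamma>"
    and X: "\<And>i. i \<in> {1..n} \<Longrightarrow> X i \<in> borel_measurable M"
    and g: "\<And>i. i \<in> {1..n} \<Longrightarrow> g i \<in> borel_measurable borel"
    and bd: "\<And>i x. i \<in> {1..n} \<Longrightarrow> lo i \<le> g i x \<and> g i x \<le> hi i"
    and E0: "\<And>i. i \<in> {1..n} \<Longrightarrow> expectation (\<lambda>\<omega>. g i (X i \<omega>)) = 0"
    and d: "\<And>i. i \<in> {1..n} \<Longrightarrow> hi i - lo i = d i \<and> d i \<le> r"
    and s: "0 < (\<Sum>i=1..n. (d i)\<^sup>2)" and \<tau>: "0 < \<tau>"
  shows "prob {\<omega> \<in> space M. \<tau> < (\<Sum>i=1..n. g i (X i \<omega>))}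
    \<le> exp (- (\<tau>\<^sup>2 / (2 * (\<Sum>j\<in>J. w j) * (\<Sum>i=1..n. (d i)\<^sup>2))))
      + 2 * real n * \<gamma> * sqrt (real n * r / \<tau>)"
proof -
  have d0: "0 \<le> d i" if "i \<in> {1..n}" for i using bd[OF that, of 0] d[OF that] by linarith
  have r: "0 \<le> r" using d[of 1] d0[of 1] n by (meson atLeastAtMost_iff order_refl order_trans)
  define W where "W = (\<Sum>j\<in>J. w j)"
  define s where "s = (\<Sum>i=1..n. (d i)\<^sup>2)"
  define D where "D = (\<Sum>i=1..n. d i)"
  have J: "finite J" and I: "\<And>j. j \<in> J \<Longrightarrow> I j \<subseteq> {1..n}" and w: "\<And>j. j \<in> J \<Longrightarrow> 0 \<le> w j"
    and ind: "\<And>j. j \<in> J \<Longrightarrow> gamma_independent M X \<gamma> (I j)"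
    using cover by (auto simp: soft_fractional_cover_def fractional_cover_def)
  have W: "1 \<le> W" unfolding W_def
    using fractional_cover_total_ge_1 cover n by (auto simp: soft_fractional_cover_def)
  have s0: "0 < s" using assms(9) by (simp add: s_def)
  define \<mu> where "\<mu> i = (\<Sum>j\<in>{j\<in>J. i \<in> I j}. w j)" for i
  have \<mu>: "1 \<le> \<mu> i" if "i \<in> {1..n}" for i
    using cover that by (auto simp: soft_fractional_cover_def fractional_cover_def \<mu>_def)
  have \<mu>_nz: "\<mu> i \<noteq> 0" if "i \<in> {1..n}" for i using \<mu>[OF that] by linarith
  have swap: "(\<Sum>j\<in>J. w j * (\<Sum>i\<in>I j. f i)) = (\<Sum>i=1..n. \<mu> i * f i)" for f
    unfolding \<mu>_def by (rule weighted_cover_sum[OF J I])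
  define Z where "Z i x = g i x / \<mu> i" for i x
  define e where "e i = d i / \<mu> i" for i
  have e: "0 \<le> e i" "e i \<le> d i" "e i \<le> r" if "i \<in> {1..n}" for i
    using \<mu>[OF that] d0[OF that] d[OF that] divide_left_mono[of 1 "\<mu> i" "d i"] by (auto simp: e_def)
  have Z_meas: "Z i \<in> borel_measurable borel" if "i \<in> {1..n}" for i
    unfolding Z_def using g[OF that] by measurable
  have Z_bd: "lo i / \<mu> i \<le> Z i x \<and> Z i x \<le> hi i / \<mu> i" if "i \<in> {1..n}" for i x
    using bd[OF that] \<mu>[OF that] by (simp add: Z_def divide_right_mono)
  have Z_d: "hi i / \<mu> i - lo i / \<mu> i = e i" if "i \<in> {1..n}" for i
    using d[OF that] by (simp add: e_def flip: diff_divide_distrib)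
  have Z_E: "expectation (\<lambda>\<omega>. Z i (X i \<omega>)) = 0" if "i \<in> {1..n}" for i
    using E0[OF that] by (simp add: Z_def)
  define Y where "Y j \<omega> = (\<Sum>i\<in>I j. Z i (X i \<omega>))" for j \<omega>
  define q where "q j = (\<Sum>i\<in>I j. (e i)\<^sup>2)" for j
  \<comment> \<open>Classes with \<open>q j = 0\<close> have \<open>Y j = 0\<close>; dropping them makes \<open>\<kappa> j = Q / sqrt (q j)\<close> meaningful.\<close>
  define J' where "J' = {j\<in>J. 0 < w j \<and> 0 < q j}"
  have J': "finite J'" "J' \<subseteq> J" using J by (auto simp: J'_def)
  have q0: "0 \<le> q j" for j by (simp add: q_def sum_nonneg)
  have Y_zero: "Y j \<omega> = 0" if j: "j \<in> J" "q j = 0" for j \<omega>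
    unfolding Y_def
  proof (rule sum.neutral, rule ballI)
    fix i assume i: "i \<in> I j"
    have i': "i \<in> {1..n}" using i I j by blast
    have "finite (I j)" using I[OF j(1)] finite_subset by blast
    then have "e i = 0" using j(2) i by (auto simp: q_def sum_nonneg_eq_0_iff)
    then have "lo i / \<mu> i = hi i / \<mu> i" using Z_d[OF i'] by linarith
    then have const: "Z i x = lo i / \<mu> i" for x using Z_bd[OF i', of x] by linarith
    then show "Z i (X i \<omega>) = 0" using Z_E[OF i'] by (simp add: const prob_space)
  qed
  have S_eq: "(\<Sum>i=1..n. g i (X i \<omega>)) = (\<Sum>j\<in>J'. w j * Y j \<omega>)" for \<omega>
  proof -
    have "(\<Sum>i=1..n. g i (X i \<omega>)) = (\<Sum>i=1..n. \<mu> i * Z i (X i \<omega>))"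
      using \<mu>_nz by (intro sum.cong) (auto simp: Z_def)
    also have "\<dots> = (\<Sum>j\<in>J. w j * Y j \<omega>)" unfolding Y_def by (rule swap[symmetric])
    also have "\<dots> = (\<Sum>j\<in>J'. w j * Y j \<omega>)"
      using J J' w q0 Y_zero by (intro sum.mono_neutral_right) (force simp: J'_def less_le)+
    finally show ?thesis .
  qed
  define Q where "Q = (\<Sum>j\<in>J'. w j * sqrt (q j))"
  \<comment> \<open>Since \<open>e i = d i / \<mu> i\<close>, one factor \<open>e i\<close> absorbs the covering weight \<open>\<mu> i\<close>.\<close>
  have ws: "(\<Sum>j\<in>J. w j * q j) \<le> s"
  proof -
    have "(\<Sum>j\<in>J. w j * q j) = (\<Sum>i=1..n. \<mu> i * (e i)\<^sup>2)" unfolding q_def by (rule swap)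
    also have "\<dots> = (\<Sum>i=1..n. d i * e i)"
      using \<mu>_nz by (intro sum.cong) (auto simp: e_def power2_eq_square)
    also have "\<dots> \<le> s" unfolding s_def power2_eq_square
      using e d0 by (intro sum_mono mult_left_mono) auto
    finally show ?thesis .
  qed
  have Q_sq: "Q\<^sup>2 \<le> W * s"
  proof -
    have "Q = (\<Sum>j\<in>J'. sqrt (w j) * sqrt (w j * q j))"
      unfolding Q_def using J' w by (intro sum.cong) (auto simp: real_sqrt_mult)
    then have "Q\<^sup>2 \<le> (\<Sum>j\<in>J'. (sqrt (w j))\<^sup>2) * (\<Sum>j\<in>J'. (sqrt (w j * q j))\<^sup>2)"
      by (simp only: Cauchy_Schwarz_ineq_sum)
    also have "\<dots> = (\<Sum>j\<in>J'. w j) * (\<Sum>j\<in>J'. w j * q j)"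
      using J' w q0 by (intro arg_cong2[of _ _ _ _ "(*)"] sum.cong) auto
    also have "\<dots> \<le> W * (\<Sum>j\<in>J. w j * q j)"
      unfolding W_def using J J' w q0
      by (intro mult_mono sum_mono2 sum_nonneg) auto
    also have "\<dots> \<le> W * s" using W ws by (intro mult_left_mono) auto
    finally show ?thesis .
  qed
  have Q0: "0 < Q"
  proof -
    have "(\<Sum>i=1..n. (d i)\<^sup>2) \<noteq> 0" using s0 by (simp add: s_def)
    then obtain i where i: "i \<in> {1..n}" "d i \<noteq> 0"
      by (rule sum.not_neutral_contains_not_neutral) auto
    have "(\<Sum>j\<in>{j\<in>J. i \<in> I j}. w j) \<noteq> 0" using \<mu>[OF i(1)] by (simp add: \<mu>_def)
    then obtain j where "j \<in> {j\<in>J. i \<in> I j}" "w j \<noteq> 0"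
      by (rule sum.not_neutral_contains_not_neutral)
    then have j: "j \<in> J" "i \<in> I j" "0 < w j" using w by (auto simp: less_le)
    have "0 < (e i)\<^sup>2" using i \<mu>[OF i(1)] by (simp add: e_def)
    also have "\<dots> \<le> q j" unfolding q_def
      using I[OF j(1)] j(2) by (intro member_le_sum) (auto intro: finite_subset)
    finally have "j \<in> J'" using j by (simp add: J'_def)
    moreover have "0 < w k * sqrt (q k)" if "k \<in> J'" for k using that by (simp add: J'_def)
    ultimately show ?thesis unfolding Q_def using J' by (intro sum_pos) auto
  qed
  define v where "v = 2 * \<tau> / (W * s)"
  define A where "A = 1 / (1 + v * \<tau> / 2)"
  \<comment> \<open>\<open>A\<close> normalises the linear part: \<open>A * (1 + v * (\<tau> - c)) = 1\<close>.\<close>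
  define c where "c = \<tau> / 2"
  have v: "0 < v" using \<tau> W s0 by (simp add: v_def)
  have A: "0 < A" "A \<le> 1" using v \<tau> by (simp_all add: A_def add_pos_pos)
  define p where "p j = w j * sqrt (q j) / Q" for j
  define \<kappa> where "\<kappa> j = Q / sqrt (q j)" for j
  have p: "0 \<le> p j" if "j \<in> J'" for j using that Q0 by (simp add: p_def J'_def)
  have p1: "(\<Sum>j\<in>J'. p j) = 1" using Q0 by (simp add: p_def Q_def flip: sum_divide_distrib)
  have \<kappa>: "0 < \<kappa> j" "p j * \<kappa> j = w j" "(\<kappa> j)\<^sup>2 * q j = Q\<^sup>2" if "j \<in> J'" for j
    using that Q0 by (auto simp: J'_def p_def \<kappa>_def power_divide)
  define \<phi> where "\<phi> j y = A * exp_linear (v * (\<kappa> j * y - c))" for j y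
  define K where "K = real n * \<gamma>"
  have \<phi>_mono: "mono (\<phi> j)" and \<phi>_Lip: "x \<le> y \<Longrightarrow> \<phi> j y - \<phi> j x \<le> (A * v * \<kappa> j) * (y - x)"
    if j: "j \<in> J'" for j x y
  proof -
    have le: "v * (\<kappa> j * x - c) \<le> v * (\<kappa> j * y - c)" if "x \<le> y" for x y
      using v \<kappa>(1)[OF j] that by (intro mult_left_mono diff_right_mono) auto
    show "mono (\<phi> j)" unfolding \<phi>_def
      by (intro monoI mult_left_mono exp_linear_increment(1) le) (use A in auto)
    assume "x \<le> y"
    from mult_left_mono[OF exp_linear_increment(2)[OF le[OF this]], of A] A
    show "\<phi> j y - \<phi> j x \<le> (A * v * \<kappa> j) * (y - x)" by (simp add: \<phi>_def algebra_simps)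
  qed
  have \<phi>_class: "expectation (\<lambda>\<omega>. \<phi> j (Y j \<omega>))
      \<le> A * exp (v\<^sup>2 * Q\<^sup>2 / 8 - v * c) + (A * v * \<kappa> j) * (K * min (\<Sum>i\<in>I j. e i) r)"
    if j: "j \<in> J'" for j
  proof -
    have jJ: "j \<in> J" using j J' by auto
    have Ij: "I j \<subseteq> {1..n}" "finite (I j)" using I[OF jJ] by (auto intro: finite_subset)
    have "card (I j) \<le> n" using card_mono[OF _ Ij(1)] by simp
    then have cK: "real (card (I j)) * \<gamma> \<le> K" using \<gamma> by (simp add: K_def mult_right_mono)
    have "expectation (\<lambda>\<omega>. \<phi> j (Y j \<omega>)) \<le> (A * exp (- (v * c))) * exp ((v * \<kappa> j)\<^sup>2 * (\<Sum>i\<in>I j. (e i)\<^sup>2) / 8)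
        + (A * v * \<kappa> j) * (K * min (\<Sum>i\<in>I j. e i) r)"
      unfolding Y_def
    proof (rule expectation_class_sum_le[OF Ij(2) ind[OF jJ] cK,
          where lo = "\<lambda>i. lo i / \<mu> i" and hi = "\<lambda>i. hi i / \<mu> i"])
      show "\<phi> j y \<le> A * exp (- (v * c)) * exp (v * \<kappa> j * y)" for y
        using mult_left_mono[OF exp_linear_le_exp[of "v * (\<kappa> j * y - c)"], of A] A
        by (simp add: \<phi>_def algebra_simps flip: exp_add)
    qed (use X Z_meas Z_bd Z_E Z_d e Ij r \<phi>_mono \<phi>_Lip j A v \<kappa>(1)[OF j] in auto)
    also have "(v * \<kappa> j)\<^sup>2 * (\<Sum>i\<in>I j. (e i)\<^sup>2) = v\<^sup>2 * Q\<^sup>2"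
      using \<kappa>(3)[OF j] by (simp add: power_mult_distrib mult.assoc flip: q_def)
    also have "A * exp (- (v * c)) * exp (v\<^sup>2 * Q\<^sup>2 / 8) = A * exp (v\<^sup>2 * Q\<^sup>2 / 8 - v * c)"
      by (simp add: mult.assoc flip: exp_add)
    finally show ?thesis .
  qed
  have Y_meas: "Y j \<in> borel_measurable M" if "j \<in> J'" for j
    unfolding Y_def
  proof (rule borel_measurable_sum)
    fix i assume "i \<in> I j"
    then have i: "i \<in> {1..n}" using that J' I by blast
    show "(\<lambda>\<omega>. Z i (X i \<omega>)) \<in> borel_measurable M"
      by (rule measurable_compose[OF X[OF i] Z_meas[OF i]])
  qed
  have Y_bd: "\<bar>Y j \<omega>\<bar> \<le> (\<Sum>i\<in>I j. \<bar>lo i / \<mu> i\<bar> + \<bar>hi i / \<mu> i\<bar>)" if "j \<in> J'" for j \<omega>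
    unfolding Y_def
  proof (rule order_trans[OF sum_abs sum_mono])
    fix i assume "i \<in> I j"
    then have "i \<in> {1..n}" using that J' I by blast
    from Z_bd[OF this, of "X i \<omega>"] show "\<bar>Z i (X i \<omega>)\<bar> \<le> \<bar>lo i / \<mu> i\<bar> + \<bar>hi i / \<mu> i\<bar>" by linarith
  qed
  have int: "integrable M (\<lambda>\<omega>. \<phi> j (Y j \<omega>))" if "j \<in> J'" for j
    by (rule integrable_bounded_mono_comp[OF \<phi>_mono[OF that] Y_meas[OF that] Y_bd[OF that]])
  have ge: "indicator {\<omega> \<in> space M. \<tau> < (\<Sum>i=1..n. g i (X i \<omega>))} \<omega> \<le> (\<Sum>j\<in>J'. p j * \<phi> j (Y j \<omega>))" for \<omega>
  proof -
    define x where "x = (\<Sum>j\<in>J'. w j * Y j \<omega>)"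
    have "(\<Sum>j\<in>J'. p j * (v * (\<kappa> j * Y j \<omega> - c))) = (\<Sum>j\<in>J'. v * (w j * Y j \<omega>) - (v * c) * p j)"
      using \<kappa>(2) by (intro sum.cong) (auto simp: algebra_simps)
    also have "\<dots> = v * (x - c)"
      unfolding sum_subtractf sum_distrib_left[symmetric] p1 x_def by (simp add: algebra_simps)
    finally have "exp_linear (v * (x - c)) \<le> (\<Sum>j\<in>J'. p j * exp_linear (v * (\<kappa> j * Y j \<omega> - c)))"
      using exp_linear_Jensen[OF J'(1) p p1, of "\<lambda>j. v * (\<kappa> j * Y j \<omega> - c)"] by simp
    then have *: "A * exp_linear (v * (x - c)) \<le> (\<Sum>j\<in>J'. p j * \<phi> j (Y j \<omega>))"
      using A by (simp add: \<phi>_def mult.left_commute mult_left_mono flip: sum_distrib_left)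
    have "of_bool (\<tau> < x) \<le> A * exp_linear (v * (x - c))"
    proof (cases "\<tau> < x")
      case True
      have "v * (\<tau> - c) \<le> v * (x - c)" using True v by (intro mult_left_mono) auto
      then have "1 + v * \<tau> / 2 \<le> 1 + v * (x - c)" by (simp add: c_def algebra_simps)
      also have "\<dots> \<le> exp_linear (v * (x - c))" by (rule exp_linear_ge)
      finally have "A * (1 + v * \<tau> / 2) \<le> A * exp_linear (v * (x - c))"
        using A by (intro mult_left_mono) auto
      moreover have "A * (1 + v * \<tau> / 2) = 1" using v \<tau> by (simp add: A_def add_pos_pos less_imp_neq[symmetric])
      ultimately show ?thesis using True by simp
    next
      case False
      then show ?thesis using A exp_linear_nonneg by simp
    qed
    moreover have "indicator {\<omega> \<in> space M. \<tau> < (\<Sum>i=1..n. g i (X i \<omega>))} \<omega> \<le> (of_bool (\<tau> < x) :: real)"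
      unfolding S_eq by (auto simp: x_def indicator_def)
    ultimately show ?thesis using * by linarith
  qed
  have S_meas: "(\<lambda>\<omega>. \<Sum>i=1..n. g i (X i \<omega>)) \<in> borel_measurable M"
    by (rule borel_measurable_sum, rule measurable_compose[OF X g])
  have ev: "{\<omega> \<in> space M. \<tau> < (\<Sum>i=1..n. g i (X i \<omega>))} \<in> events"
    using S_meas by measurable
  have "prob {\<omega> \<in> space M. \<tau> < (\<Sum>i=1..n. g i (X i \<omega>))}
      = expectation (indicator {\<omega> \<in> space M. \<tau> < (\<Sum>i=1..n. g i (X i \<omega>))})"
    using ev by simp
  also have "\<dots> \<le> expectation (\<lambda>\<omega>. \<Sum>j\<in>J'. p j * \<phi> j (Y j \<omega>))"
    using ge ev int by (intro integral_mono) (auto simp: emeasure_eq_measure)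
  also have "\<dots> = (\<Sum>j\<in>J'. p j * expectation (\<lambda>\<omega>. \<phi> j (Y j \<omega>)))"
    using int by (simp add: Bochner_Integration.integral_sum)
  also have "\<dots> \<le> (\<Sum>j\<in>J'. p j * (A * exp (v\<^sup>2 * Q\<^sup>2 / 8 - v * c)
      + (A * v * \<kappa> j) * (K * min (\<Sum>i\<in>I j. e i) r)))"
    by (intro sum_mono mult_left_mono \<phi>_class p)
  also have "\<dots> = (\<Sum>j\<in>J'. (A * exp (v\<^sup>2 * Q\<^sup>2 / 8 - v * c)) * p j
      + (A * v * K) * (w j * min (\<Sum>i\<in>I j. e i) r))"
    by (intro sum.cong refl) (simp add: algebra_simps flip: \<kappa>(2))
  also have "\<dots> = A * exp (v\<^sup>2 * Q\<^sup>2 / 8 - v * c)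
      + (A * v * K) * (\<Sum>j\<in>J'. w j * min (\<Sum>i\<in>I j. e i) r)"
    unfolding sum.distrib sum_distrib_left[symmetric] p1 by simp
  also have "A * exp (v\<^sup>2 * Q\<^sup>2 / 8 - v * c) \<le> exp (- (\<tau>\<^sup>2 / (2 * W * s)))"
  proof -
    have "v\<^sup>2 * Q\<^sup>2 / 8 - v * c \<le> v\<^sup>2 * (W * s) / 8 - v * c"
      using Q_sq by (intro diff_right_mono divide_right_mono mult_left_mono) auto
    also have "\<dots> = - (\<tau>\<^sup>2 / (2 * W * s))"
      using W s0 by (simp add: v_def c_def field_simps power2_eq_square)
    finally have "exp (v\<^sup>2 * Q\<^sup>2 / 8 - v * c) \<le> exp (- (\<tau>\<^sup>2 / (2 * W * s)))" by simp
    moreover have "A * exp (v\<^sup>2 * Q\<^sup>2 / 8 - v * c) \<le> 1 * exp (v\<^sup>2 * Q\<^sup>2 / 8 - v * c)"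
      using A by (intro mult_right_mono) auto
    ultimately show ?thesis by linarith
  qed
  also have "(A * v * K) * (\<Sum>j\<in>J'. w j * min (\<Sum>i\<in>I j. e i) r) \<le> (A * v * K) * min D (r * W)"
  proof (rule mult_left_mono)
    have e_sum0: "0 \<le> (\<Sum>i\<in>I j. e i)" if "j \<in> J" for j
      using e(1) I[OF that] by (intro sum_nonneg) blast
    have "(\<Sum>j\<in>J'. w j * min (\<Sum>i\<in>I j. e i) r) \<le> (\<Sum>j\<in>J. w j * min (\<Sum>i\<in>I j. e i) r)"
      using J J' w e_sum0 r by (intro sum_mono2) auto
    moreover have "\<dots> \<le> (\<Sum>j\<in>J. w j * (\<Sum>i\<in>I j. e i))"
      using w by (intro sum_mono mult_left_mono) auto
    moreover have "\<dots> = (\<Sum>i=1..n. \<mu> i * e i)" by (rule swap)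
    moreover have "\<dots> = D" unfolding D_def using \<mu>_nz by (intro sum.cong) (auto simp: e_def)
    moreover have "(\<Sum>j\<in>J. w j * min (\<Sum>i\<in>I j. e i) r) \<le> (\<Sum>j\<in>J. w j * r)"
      using w by (intro sum_mono mult_left_mono) auto
    moreover have "\<dots> = r * W" by (simp add: W_def mult.commute flip: sum_distrib_left)
    ultimately show "(\<Sum>j\<in>J'. w j * min (\<Sum>i\<in>I j. e i) r) \<le> min D (r * W)" by simp
  qed (use A v \<gamma> in \<open>simp add: K_def\<close>)
  also have "(A * v * K) * min D (r * W) = K * (v / (1 + v * \<tau> / 2) * min D (r * W))"
    by (simp add: A_def)
  also have "\<dots> \<le> K * (2 * sqrt (real n * r / \<tau>))"
    unfolding v_def
  proof (intro mult_left_mono truncation_error_le)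
    show "D\<^sup>2 \<le> real n * s"
      using Cauchy_Schwarz_ineq_sum[of "\<lambda>_. 1" d "{1..n}"] by (simp add: D_def s_def)
    have "D \<le> (\<Sum>i=1..n. r)" unfolding D_def using d by (intro sum_mono) auto
    then show "D \<le> real n * r" by simp
    show "0 \<le> D" unfolding D_def using d0 by (intro sum_nonneg) auto
  qed (use \<tau> W s0 r \<gamma> in \<open>auto simp: K_def\<close>)
  finally show ?thesis by (simp add: W_def s_def K_def mult_ac)
qed

end

context prob_space
begin

text \<open>
  The variables are clamped to \<open>[a i, b i]\<close>, which changes them on a null set only, so that the bounds
  hold at every point; the clamped variable remains a function of \<open>X i\<close>, hence the dependence
  coefficients of \<open>X\<close> still apply to it.
\<close>

lemma soft_cover_tail_bound:
  fixes X :: "nat \<Rightarrow> _ \<Rightarrow> real" and a b w :: "nat \<Rightarrow> real"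
  assumes cover: "soft_fractional_cover M X n \<gamma> J I w" and n: "1 \<le> n" and \<gamma>: "0 \<le> \<gamma>"
    and X: "\<And>i. i \<in> {1..n} \<Longrightarrow> X i \<in> borel_measurable M"
    and bd: "\<And>i. i \<in> {1..n} \<Longrightarrow> AE \<omega> in M. a i \<le> X i \<omega> \<and> X i \<omega> \<le> b i"
    and r: "\<And>i. i \<in> {1..n} \<Longrightarrow> b i - a i \<le> r"
    and s: "0 < (\<Sum>i=1..n. (b i - a i)\<^sup>2)" and \<tau>: "0 < \<tau>"
  shows "prob {\<omega> \<in> space M. \<tau> < (\<Sum>i=1..n. X i \<omega> - expectation (X i))}
    \<le> exp (- (\<tau>\<^sup>2 / (2 * (\<Sum>j\<in>J. w j) * (\<Sum>i=1..n. (b i - a i)\<^sup>2))))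
      + 2 * real n * \<gamma> * sqrt (real n * r / \<tau>)"
proof -
  define g where "g i x = max (a i) (min (b i) x) - expectation (X i)" for i x
  have ab: "a i \<le> b i" if "i \<in> {1..n}" for i
  proof -
    have "AE \<omega> in M. a i \<le> b i" using bd[OF that] by eventually_elim simp
    then show ?thesis by simp
  qed
  have g_meas: "g i \<in> borel_measurable borel" for i
    unfolding g_def by measurable
  have gX_meas: "(\<lambda>\<omega>. g i (X i \<omega>)) \<in> borel_measurable M" if "i \<in> {1..n}" for i
    by (rule measurable_compose[OF X[OF that] g_meas])
  have gX: "AE \<omega> in M. g i (X i \<omega>) = X i \<omega> - expectation (X i)" if "i \<in> {1..n}" for i
    using bd[OF that] by eventually_elim (simp add: g_def)
  have int: "integrable M (X i)" if i: "i \<in> {1..n}" for i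
  proof (rule integrable_const_bound[OF _ X[OF i]])
    show "AE \<omega> in M. norm (X i \<omega>) \<le> \<bar>a i\<bar> + \<bar>b i\<bar>" using bd[OF i] by eventually_elim auto
  qed
  have E0: "expectation (\<lambda>\<omega>. g i (X i \<omega>)) = 0" if i: "i \<in> {1..n}" for i
  proof -
    have "expectation (\<lambda>\<omega>. g i (X i \<omega>)) = expectation (\<lambda>\<omega>. X i \<omega> - expectation (X i))"
      using gX_meas[OF i] X[OF i] gX[OF i] by (intro integral_cong_AE) auto
    then show ?thesis using int[OF i] by (simp add: prob_space)
  qed
  have "AE \<omega> in M. \<forall>i\<in>{1..n}. g i (X i \<omega>) = X i \<omega> - expectation (X i)"
    by (rule AE_ball_countable') (use gX in auto)
  then have ae: "AE \<omega> in M. (\<Sum>i=1..n. X i \<omega> - expectation (X i)) = (\<Sum>i=1..n. g i (X i \<omega>))"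
    by eventually_elim simp
  have S: "(\<lambda>\<omega>. \<Sum>i=1..n. X i \<omega> - expectation (X i)) \<in> borel_measurable M"
    using X by (intro borel_measurable_sum borel_measurable_diff) auto
  have T: "(\<lambda>\<omega>. \<Sum>i=1..n. g i (X i \<omega>)) \<in> borel_measurable M"
    using gX_meas by (intro borel_measurable_sum) auto
  have "prob {\<omega> \<in> space M. \<tau> < (\<Sum>i=1..n. X i \<omega> - expectation (X i))}
      = prob {\<omega> \<in> space M. \<tau> < (\<Sum>i=1..n. g i (X i \<omega>))}"
  proof (rule measure_eq_AE)
    show "AE \<omega> in M. \<omega> \<in> {\<omega> \<in> space M. \<tau> < (\<Sum>i=1..n. X i \<omega> - expectation (X i))}
        \<longleftrightarrow> \<omega> \<in> {\<omega> \<in> space M. \<tau> < (\<Sum>i=1..n. g i (X i \<omega>))}"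
      using ae by eventually_elim simp
  qed (use S T in measurable)
  also have "\<dots> \<le> exp (- (\<tau>\<^sup>2 / (2 * (\<Sum>j\<in>J. w j) * (\<Sum>i=1..n. (b i - a i)\<^sup>2))))
      + 2 * real n * \<gamma> * sqrt (real n * r / \<tau>)"
  proof (rule soft_cover_tail_bound_centered[OF cover n \<gamma> X g_meas _ E0 _ s \<tau>])
    show "a i - expectation (X i) \<le> g i x \<and> g i x \<le> b i - expectation (X i)"
      if "i \<in> {1..n}" for i x using ab[OF that] by (simp add: g_def)
    show "(b i - expectation (X i)) - (a i - expectation (X i)) = b i - a i \<and> b i - a i \<le> r"
      if "i \<in> {1..n}" for i using r[OF that] by simp
  qed
  finally show ?thesis .
qed

end

section \<open>Passing to the infimum over all covers\<close>

lemma singletons_soft_fractional_cover: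
  assumes "0 \<le> \<gamma>"
  shows "soft_fractional_cover M X n \<gamma> {1..n} (\<lambda>j. {j}) (\<lambda>_. 1)"
proof -
  have "{j \<in> {1..n}. i = j} = {i}" if "i \<in> {1..n}" for i using that by auto
  then show ?thesis using assms
    by (simp add: soft_fractional_cover_def fractional_cover_def gamma_independent_def
        alpha_separation_def)
qed

text \<open>
  This passes from single covers to the infimum of their weights, attained or not:
  for \<open>q > 0\<close> the inequality says \<open>K / (- ln q) \<le> W\<close>, a lower bound on \<open>W\<close>.
\<close>

lemma le_exp_at_Inf:
  fixes S :: "real set"
  assumes "S \<noteq> {}" "\<And>W. W \<in> S \<Longrightarrow> 1 \<le> W" "\<And>W. W \<in> S \<Longrightarrow> q \<le> exp (- (K / W))" "0 < K"
  shows "q \<le> exp (- (K / Inf S))"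
proof (cases "q \<le> 0")
  case True
  then show ?thesis using exp_ge_zero order_trans by blast
next
  case False
  have Inf1: "1 \<le> Inf S" using assms by (intro cInf_greatest)
  have *: "K / W \<le> - ln q" if "W \<in> S" for W
  proof -
    have "ln q \<le> ln (exp (- (K / W)))" using assms(3)[OF that] False by (intro ln_mono) auto
    then show ?thesis by simp
  qed
  obtain W where "W \<in> S" using assms(1) by blast
  then have "0 < K / W" using assms(2)[of W] assms(4) by simp
  then have pos: "0 < - ln q" using *[OF \<open>W \<in> S\<close>] by linarith
  have "K / - ln q \<le> Inf S"
  proof (rule cInf_greatest[OF assms(1)])
    fix W assume W: "W \<in> S"
    have "0 < W" using assms(2)[OF W] by simp
    with *[OF W] pos show "K / - ln q \<le> W" by (simp add: field_simps)
  qed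
  then have "K / Inf S \<le> - ln q" using pos Inf1 by (simp add: field_simps)
  then have "exp (ln q) \<le> exp (- (K / Inf S))" by simp
  then show ?thesis using False by simp
qed

theorem theorem3:
  fixes M :: "'a measure" and X :: "nat \<Rightarrow> 'a \<Rightarrow> real" and a b :: "nat \<Rightarrow> real"
    and n :: nat and \<gamma> t l :: real
  assumes "prob_space M"
    and "n \<ge> 1"
    and "\<And>i. i \<in> {1..n} \<Longrightarrow> X i \<in> borel_measurable M"
    and "\<And>i. i \<in> {1..n} \<Longrightarrow> AE \<omega> in M. a i \<le> X i \<omega> \<and> X i \<omega> \<le> b i"
    and "\<gamma> > 0" and "t > 0" and "0 < l" and "l < t"
  shows
    "let r = (MAX i\<in>{1..n}. \<bar>b i - a i\<bar>);
         chi = soft_fractional_chromatic M X n \<gamma>;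
         s = (\<Sum>i=1..n. (b i - a i)\<^sup>2);
         p = measure M {\<omega> \<in> space M.
               (1 / real n) * (\<Sum>i=1..n. X i \<omega>)
                 - (1 / real n) * (\<Sum>i=1..n. integral\<^sup>L M (X i)) > t};
         bound1 = exp (- ((real n)\<^sup>2 * (t - l)\<^sup>2 / (2 * chi * s)))
                + exp (- ((real n)\<^sup>2 * (t - l)\<^sup>2 / (2 * s)))
                + 18 * real n * \<gamma> * sqrt (r / l);
         bound2 = 2 * exp (- ((real n)\<^sup>2 * (t - l)\<^sup>2 / (2 * chi * s)))
                + 18 * real n * \<gamma> * sqrt (r / l)
     in p \<le> bound1 \<and> bound1 \<le> bound2 \<and> p \<le> bound2"
proof -
  interpret prob_space M by (rule assms(1))
  define r where "r = (MAX i\<in>{1..n}. \<bar>b i - a i\<bar>)"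
  define chi where "chi = soft_fractional_chromatic M X n \<gamma>"
  define s where "s = (\<Sum>i=1..n. (b i - a i)\<^sup>2)"
  define p where "p = prob {\<omega> \<in> space M. (1 / real n) * (\<Sum>i=1..n. X i \<omega>)
                 - (1 / real n) * (\<Sum>i=1..n. expectation (X i)) > t}"
  define E where "E = 18 * real n * \<gamma> * sqrt (r / l)"
  define S where "S = {\<Sum>j\<in>J. w j | J I w. soft_fractional_cover M X n \<gamma> J I w}"
  have ri: "\<bar>b i - a i\<bar> \<le> r" if "i \<in> {1..n}" for i
    unfolding r_def using that by (intro Max_ge) auto
  have r0: "0 \<le> r" using ri[of 1] assms(2) by force
  have S_ge: "1 \<le> W" if "W \<in> S" for W
    using that fractional_cover_total_ge_1[OF _ assms(2)]
    by (auto simp: S_def soft_fractional_cover_def)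
  have S_ne: "S \<noteq> {}"
    using singletons_soft_fractional_cover[of \<gamma> M X n] assms(5) unfolding S_def by fastforce
  have chi: "1 \<le> chi"
    unfolding chi_def soft_fractional_chromatic_def S_def[symmetric]
    by (rule cInf_greatest[OF S_ne S_ge])
  have s0: "0 \<le> s" by (simp add: s_def sum_nonneg)
  define N where "N = (real n)\<^sup>2 * (t - l)\<^sup>2"
  have exps: "exp (- (N / (2 * s))) \<le> exp (- (N / (2 * chi * s)))"
  proof (cases "s = 0")
    case False
    then have "2 * s \<le> 2 * chi * s" using chi s0 by simp
    then show ?thesis using False s0 by (simp add: N_def frac_le)
  qed simp
  have p_le: "p \<le> exp (- (N / (2 * chi * s))) + E"
  proof (cases "s = 0")
    case True
    \<comment> \<open>Division by \<open>s = 0\<close> gives \<open>0\<close>, so the exponential is \<open>1\<close> and bounds every probability.\<close>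
    have "0 \<le> E" using assms r0 by (simp add: E_def)
    then show ?thesis using True prob_le_1 by (simp add: p_def add_increasing2)
  next
    case False
    then have s_pos: "0 < s" using s0 by simp
    have p_eq: "p = prob {\<omega> \<in> space M. real n * t < (\<Sum>i=1..n. X i \<omega> - expectation (X i))}"
      unfolding p_def using assms(2) by (simp add: sum_subtractf field_simps)
    \<comment> \<open>the error term of the sharper bound, at \<open>t\<close> in place of \<open>l\<close>\<close>
  define E' where "E' = 2 * real n * \<gamma> * sqrt (r / t)"
    have "p - E' \<le> exp (- (((real n * t)\<^sup>2 / (2 * s)) / Inf S))"
    proof (rule le_exp_at_Inf[OF S_ne S_ge])
      fix W assume "W \<in> S"
      then obtain J I w where W: "W = (\<Sum>j\<in>J. w j)" and cover: "soft_fractional_cover M X n \<gamma> J I w"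
        by (auto simp: S_def)
      have "p \<le> exp (- ((real n * t)\<^sup>2 / (2 * W * s))) + 2 * real n * \<gamma> * sqrt (real n * r / (real n * t))"
        unfolding p_eq W s_def
        by (rule soft_cover_tail_bound[OF cover assms(2) _ assms(3,4)])
          (use assms ri s_pos in \<open>auto simp: s_def abs_le_iff\<close>)
      then show "p - E' \<le> exp (- (((real n * t)\<^sup>2 / (2 * s)) / W))"
        using assms(2) by (simp add: E'_def mult_ac)
    qed (use assms(2,6) s_pos in auto)
    then have "p \<le> exp (- ((real n * t)\<^sup>2 / (2 * chi * s))) + E'"
      by (simp add: chi_def soft_fractional_chromatic_def S_def mult_ac)
    moreover have "exp (- ((real n * t)\<^sup>2 / (2 * chi * s))) \<le> exp (- (N / (2 * chi * s)))"
      using assms chi s_pos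
      by (auto simp: N_def power_mult_distrib intro!: divide_right_mono mult_left_mono power_mono)
    moreover have "E' \<le> E"
    proof -
      have "2 * real n * \<gamma> \<le> 18 * real n * \<gamma>" using assms(5) by (simp add: mult_right_mono)
      moreover have "sqrt (r / t) \<le> sqrt (r / l)" using assms(6-8) r0 by (simp add: frac_le)
      moreover have "0 \<le> 18 * real n * \<gamma>" using assms(5) by simp
      moreover have "0 \<le> sqrt (r / t)" using r0 assms(6) by simp
      ultimately show ?thesis unfolding E'_def E_def by (rule mult_mono)
    qed
    ultimately show ?thesis by linarith
  qed
  have le1: "p \<le> exp (- (N / (2 * chi * s))) + exp (- (N / (2 * s))) + E"
    using p_le exp_ge_zero[of "- (N / (2 * s))"] by linarith
  have le2: "exp (- (N / (2 * chi * s))) + exp (- (N / (2 * s))) + E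
      \<le> 2 * exp (- (N / (2 * chi * s))) + E"
    using exps by linarith
  show ?thesis
    using conjI[OF le1 conjI[OF le2 order_trans[OF le1 le2]]]
    unfolding Let_def p_def N_def E_def r_def chi_def s_def .
qed

end
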